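(* Let $j:V\to M$ be an elementary embedding into a transitive class $M$ with critical point $\kappa$ and $M^\kappa\subseteq M$. Let $U=\{X\subseteq\kappa\mid\kappa\in j(X)\}$ be the derived normal ultrafilter, $i_U:V\to M_U$ its ultrapower embedding, and $k:M_U\to M$ the factor map $k([f]_U)=j(f)(\kappa)$ (so $k\circ i_U=j$). Suppose that $j[\kappa^+]\in M$ and $k[i_U(\kappa)^+]\in M$, where $i_U(\kappa)^+$ is computed in $M_U$. Then there is a $\kappa$-complete ultrafilter $W$ over $\kappa$ which is not Galvin, i.e., there is a sequence $\langle A_i\mid i<\kappa^+\rangle$ of members of $W$ such that $\bigcap_{i\in I}A_i\notin W$ for every $I\in[\kappa^+]^\kappa$.
   Context: For a function $f$ and set $X$, $f[X]=\{f(x)\mid x\in X\}$. *)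

theory Defs
  imports Main "HOL-Library.Equipollence"
begin

section \<open>The universe of sets\<close>

text \<open>
  A type of this class is a universe \<open>V\<close> of ZFC, presented by the extension map \<open>elts\<close>:
  a collection \<open>X :: 'a set\<close> is a set of the universe iff \<open>X \<in> range elts\<close>, and an arbitrary
  \<open>X :: 'a set\<close> is a (possibly proper) class.  Separation and Replacement range over all
  classes and all class functions of the type, in particular over those defined from an
  elementary embedding.  The empty set is given by \<open>elts_down\<close>; Choice is inherited from HOL.
\<close>

class zfc_universe =
  fixes elts :: "'a \<Rightarrow> 'a set"
  assumes elts_ext: "elts x = elts y \<Longrightarrow> x = y"
    and elts_down: "X \<subseteq> elts x \<Longrightarrow> X \<in> range elts"
    and elts_Union: "X \<in> range elts \<Longrightarrow> \<Union> (elts ` X) \<in> range elts"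
    and elts_Pow: "{y. elts y \<subseteq> elts x} \<in> range elts"
    and elts_replacement: "X \<in> range elts \<Longrightarrow> f ` X \<in> range elts"
    and elts_infinity: "range (g :: nat \<Rightarrow> 'a) \<in> range elts"
    and elts_foundation: "wf {(x, y). x \<in> elts y}"

text \<open>The set with the given extension; meaningful only for \<open>X \<in> range elts\<close>.\<close>

definition vset :: "'v::zfc_universe set \<Rightarrow> 'v" where
  "vset X = (THE x. elts x = X)"

lemma elts_vset:
  assumes "X \<in> range elts"
  shows "elts (vset X) = X"
proof -
  from assms obtain x where x: "X = elts x" by blast
  have "(THE y. elts y = X) = x"
    by (rule the_equality) (simp_all add: x elts_ext)
  then show ?thesis by (simp add: vset_def x)
qed

definition image_set :: "('v \<Rightarrow> 'v) \<Rightarrow> 'v::zfc_universe \<Rightarrow> 'v" where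
  "image_set f x = vset (f ` elts x)"

lemma elts_image_set: "elts (image_set f x) = f ` elts x"
  unfolding image_set_def by (intro elts_vset elts_replacement rangeI)

definition transitive_class :: "'v::zfc_universe set \<Rightarrow> bool" where
  "transitive_class N \<longleftrightarrow> (\<forall>x\<in>N. elts x \<subseteq> N)"

text \<open>By Foundation, the usual well-ordering requirement is automatic.\<close>

definition ordinal :: "'v::zfc_universe \<Rightarrow> bool" where
  "ordinal \<alpha> \<longleftrightarrow> transitive_class (elts \<alpha>) \<and> (\<forall>\<beta>\<in>elts \<alpha>. transitive_class (elts \<beta>))"

definition vpair :: "'v::zfc_universe \<Rightarrow> 'v \<Rightarrow> 'v" where
  "vpair x y = vset {vset {x}, vset {x, y}}"

text \<open>By Replacement, the set functions with domain \<open>A\<close> are exactly the graphs over \<open>A\<close> of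
  class functions.\<close>

definition fun_graph :: "'v::zfc_universe \<Rightarrow> ('v \<Rightarrow> 'v) \<Rightarrow> 'v" where
  "fun_graph A F = vset ((\<lambda>x. vpair x (F x)) ` elts A)"

definition function_on :: "'v::zfc_universe \<Rightarrow> 'v \<Rightarrow> bool" where
  "function_on A f \<longleftrightarrow> (\<exists>F. f = fun_graph A F)"

definition app :: "'v::zfc_universe \<Rightarrow> 'v \<Rightarrow> 'v" where
  "app f x = (THE y. vpair x y \<in> elts f)"

lemma vset_finite:
  assumes "finite X"
  shows "(X :: 'v::zfc_universe set) \<in> range elts"
proof -
  from assms obtain n and g :: "nat \<Rightarrow> 'v" where "X = g ` {i. i < n}"
    using finite_imp_nat_seg_image_inj_on by blast
  then have "X \<subseteq> range g" by blast
  moreover obtain y :: 'v where "range g = elts y"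
    using elts_infinity[of g] by blast
  ultimately show ?thesis using elts_down[of X y] by simp
qed

lemma vpair_eq_iff: "vpair x y = vpair x' y' \<longleftrightarrow> x = x' \<and> (y :: 'v::zfc_universe) = y'"
proof
  assume *: "vpair x y = vpair x' y'"
  have elts_vpair: "elts ` elts (vpair u v) = {{u}, {u, v}}" for u v :: 'v
  proof -
    have "elts (vset {a, b}) = {a, b}" for a b :: 'v
      by (intro elts_vset vset_finite) simp
    from this[of u u] this[of u v] this[of "vset {u}" "vset {u, v}"] show ?thesis
      unfolding vpair_def by simp
  qed
  have "{{x}, {x, y}} = {{x'}, {x', y'}}"
    using elts_vpair[of x y] elts_vpair[of x' y'] * by simp
  then show "x = x' \<and> y = y'"
    by (auto simp: doubleton_eq_iff)
qed simp

lemma app_fun_graph: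
  assumes "x \<in> elts A"
  shows "app (fun_graph A F) x = F x"
proof -
  have "elts (fun_graph A F) = (\<lambda>x. vpair x (F x)) ` elts A"
    unfolding fun_graph_def by (intro elts_vset elts_replacement rangeI)
  then have "vpair x y \<in> elts (fun_graph A F) \<longleftrightarrow> y = F x" for y
    using assms by (auto simp: vpair_eq_iff)
  then show ?thesis
    by (simp add: app_def)
qed

section \<open>Cardinals, possibly computed in a transitive class\<close>

text \<open>\<open>\<alpha>\<close> is a cardinal in the sense of the transitive class \<open>N\<close>; for \<open>N = UNIV\<close> this is
  being a cardinal.\<close>

definition cardinal_in :: "'v::zfc_universe set \<Rightarrow> 'v \<Rightarrow> bool" where
  "cardinal_in N \<alpha> \<longleftrightarrow> \<alpha> \<in> N \<and> ordinal \<alpha> \<and>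
     (\<forall>\<beta>\<in>elts \<alpha>. \<not> (\<exists>f\<in>N. function_on \<beta> f \<and> bij_betw (app f) (elts \<beta>) (elts \<alpha>)))"

definition succ_cardinal_in :: "'v::zfc_universe set \<Rightarrow> 'v \<Rightarrow> 'v" where
  "succ_cardinal_in N \<kappa> = (THE \<theta>. cardinal_in N \<theta> \<and> \<kappa> \<in> elts \<theta> \<and>
     (\<forall>\<mu>\<in>elts \<theta>. cardinal_in N \<mu> \<longrightarrow> \<kappa> \<notin> elts \<mu>))"

abbreviation succ_cardinal :: "'v::zfc_universe \<Rightarrow> 'v" where
  "succ_cardinal \<equiv> succ_cardinal_in UNIV"

section \<open>Elementary embeddings\<close>

datatype fm = Mem nat nat | Eq nat nat | Neg fm | Conj fm fm | Forall nat fm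

primrec sat :: "'v::zfc_universe set \<Rightarrow> (nat \<Rightarrow> 'v) \<Rightarrow> fm \<Rightarrow> bool" where
  "sat N s (Mem m n) \<longleftrightarrow> s m \<in> elts (s n)"
| "sat N s (Eq m n) \<longleftrightarrow> s m = s n"
| "sat N s (Neg p) \<longleftrightarrow> \<not> sat N s p"
| "sat N s (Conj p q) \<longleftrightarrow> sat N s p \<and> sat N s q"
| "sat N s (Forall n p) \<longleftrightarrow> (\<forall>a\<in>N. sat N (s(n := a)) p)"

definition elementary_embedding ::
  "('v::zfc_universe \<Rightarrow> 'v) \<Rightarrow> 'v set \<Rightarrow> 'v set \<Rightarrow> bool" where
  "elementary_embedding j N M \<longleftrightarrow> j ` N \<subseteq> M \<and>
     (\<forall>p s. range s \<subseteq> N \<longrightarrow> (sat N s p \<longleftrightarrow> sat M (j \<circ> s) p))"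

definition critical_point :: "('v::zfc_universe \<Rightarrow> 'v) \<Rightarrow> 'v \<Rightarrow> bool" where
  "critical_point j \<kappa> \<longleftrightarrow> ordinal \<kappa> \<and> j \<kappa> \<noteq> \<kappa> \<and> (\<forall>\<alpha>\<in>elts \<kappa>. j \<alpha> = \<alpha>)"

definition closed_under_sequences :: "'v::zfc_universe \<Rightarrow> 'v set \<Rightarrow> bool" where
  "closed_under_sequences \<kappa> M \<longleftrightarrow> (\<forall>F. F ` elts \<kappa> \<subseteq> M \<longrightarrow> fun_graph \<kappa> F \<in> M)"

section \<open>Ultrafilters and ultrapowers\<close>

text \<open>The intersection of the subsets \<open>A i\<close> (\<open>i \<in> I\<close>) of \<open>\<kappa>\<close>; it is \<open>\<kappa>\<close> if \<open>I\<close> is empty.\<close>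

definition vInter :: "'v::zfc_universe \<Rightarrow> 'v \<Rightarrow> ('v \<Rightarrow> 'v) \<Rightarrow> 'v" where
  "vInter \<kappa> I A = vset {\<xi> \<in> elts \<kappa>. \<forall>i\<in>elts I. \<xi> \<in> elts (A i)}"

definition ultrafilter_over :: "'v::zfc_universe \<Rightarrow> 'v \<Rightarrow> bool" where
  "ultrafilter_over \<kappa> W \<longleftrightarrow>
     (\<forall>X\<in>elts W. elts X \<subseteq> elts \<kappa>) \<and> \<kappa> \<in> elts W \<and> vset {} \<notin> elts W \<and>
     (\<forall>X\<in>elts W. \<forall>Y. elts X \<subseteq> elts Y \<and> elts Y \<subseteq> elts \<kappa> \<longrightarrow> Y \<in> elts W) \<and>
     (\<forall>X\<in>elts W. \<forall>Y\<in>elts W. vset (elts X \<inter> elts Y) \<in> elts W) \<and>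
     (\<forall>X. elts X \<subseteq> elts \<kappa> \<longrightarrow> X \<in> elts W \<or> vset (elts \<kappa> - elts X) \<in> elts W)"

definition complete_ultrafilter_over :: "'v::zfc_universe \<Rightarrow> 'v \<Rightarrow> bool" where
  "complete_ultrafilter_over \<kappa> W \<longleftrightarrow> ultrafilter_over \<kappa> W \<and>
     (\<forall>\<gamma>\<in>elts \<kappa>. \<forall>A. A ` elts \<gamma> \<subseteq> elts W \<longrightarrow> vInter \<kappa> \<gamma> A \<in> elts W)"

definition derived_ultrafilter :: "('v::zfc_universe \<Rightarrow> 'v) \<Rightarrow> 'v \<Rightarrow> 'v" where
  "derived_ultrafilter j \<kappa> = vset {X. elts X \<subseteq> elts \<kappa> \<and> \<kappa> \<in> elts (j X)}"

definition ult_rel :: "'v::zfc_universe \<Rightarrow> 'v \<Rightarrow> ('v \<times> 'v) set" where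
  "ult_rel \<kappa> U = {(f, g). function_on \<kappa> f \<and> function_on \<kappa> g \<and>
     vset {\<alpha> \<in> elts \<kappa>. app f \<alpha> \<in> elts (app g \<alpha>)} \<in> elts U}"

text \<open>\<open>ult_class \<kappa> U f\<close> is \<open>[f]\<^sub>U\<close>, the image of the class of \<open>f\<close> in the transitive collapse of
  the ultrapower: it is determined by \<open>[g]\<^sub>U = {[f]\<^sub>U | f \<in>\<^sub>U g}\<close>, where \<open>f \<in>\<^sub>U g\<close> means
  \<open>(f, g) \<in> ult_rel \<kappa> U\<close>.  This recursion is legitimate when \<open>U\<close> is countably complete.\<close>

definition ult_class :: "'v::zfc_universe \<Rightarrow> 'v \<Rightarrow> 'v \<Rightarrow> 'v" where
  "ult_class \<kappa> U = wfrec (ult_rel \<kappa> U) (\<lambda>C g. vset (C ` {f. (f, g) \<in> ult_rel \<kappa> U}))"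

definition ultrapower :: "'v::zfc_universe \<Rightarrow> 'v \<Rightarrow> 'v set" where
  "ultrapower \<kappa> U = ult_class \<kappa> U ` {f. function_on \<kappa> f}"

definition ult_embedding :: "'v::zfc_universe \<Rightarrow> 'v \<Rightarrow> 'v \<Rightarrow> 'v" where
  "ult_embedding \<kappa> U x = ult_class \<kappa> U (fun_graph \<kappa> (\<lambda>_. x))"

text \<open>The map \<open>[f]\<^sub>U \<mapsto> j(f)(\<kappa>)\<close> on the ultrapower by the ultrafilter derived from \<open>j\<close>;
  unspecified outside the ultrapower.\<close>

definition factor_map :: "('v::zfc_universe \<Rightarrow> 'v) \<Rightarrow> 'v \<Rightarrow> 'v \<Rightarrow> 'v" where
  "factor_map j \<kappa> y = (THE z. \<exists>f. function_on \<kappa> f \<and>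
     ult_class \<kappa> (derived_ultrafilter j \<kappa>) f = y \<and> z = app (j f) \<kappa>)"

end

theory Submission
  imports Defs
begin

text \<open>
  Fix distinct subsets \<open>x\<^sub>i\<close> (\<open>i < \<kappa>\<^sup>+\<close>) of \<open>\<kappa>\<close>, an injective coding \<open>c\<close> of the pairs \<open>(\<beta>, S)\<close> with
  \<open>\<beta> < \<kappa>\<close> and \<open>S \<subseteq> P(\<beta>)\<close> by ordinals below \<open>\<kappa>\<close>, and let \<open>A\<^sub>i = {c(\<beta>, S) | x\<^sub>i \<inter> \<beta> \<in> S}\<close>.  Call
  \<open>D \<subseteq> \<kappa>\<^sup>+\<close> small if some \<open>\<nu> < \<kappa>\<close> separates the sets \<open>x\<^sub>i\<close>, \<open>i \<in> D\<close>.  For every small \<open>D\<close> the image of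
  \<open>U\<close> under \<open>\<xi> \<mapsto> c(\<xi>, {x\<^sub>i \<inter> \<xi> | i \<in> D})\<close> is a \<open>\<kappa>\<close>-complete ultrafilter containing \<open>A\<^sub>i\<close> exactly for
  \<open>i \<in> D\<close>.  In \<open>M\<close> the set \<open>j[\<kappa>\<^sup>+]\<close> is small for \<open>j(x)\<close>, as witnessed by \<open>\<nu> = \<kappa> < j(\<kappa>)\<close>.  Elementarity gives
  \<open>W' \<in> M\<close> that contains \<open>j(A)\<^sub>i\<close> exactly for \<open>i \<in> j[\<kappa>\<^sup>+]\<close>, and \<open>W = {X \<subseteq> \<kappa> | j(X) \<in> W'}\<close> is as required:
  if \<open>I\<close> is enumerated injectively by \<open>g\<close> on \<open>\<kappa>\<close>, then \<open>t = j(g)(\<kappa>)\<close> lies in \<open>j(I)\<close> but not in the range of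
  \<open>j\<close>, so \<open>j(A)\<^sub>t \<notin> W'\<close>.

  Note that \<open>W\<close> need not be derived from \<open>j\<close> itself: its seed lives in the ultrapower of \<open>M\<close> by \<open>j(U)\<close>.
\<close>

section \<open>Sets and membership\<close>

lemma small_subset: "X \<subseteq> elts x \<Longrightarrow> elts (vset X) = X"
  by (intro elts_vset elts_down)

lemma small_Un:
  assumes "X \<in> range elts" "Y \<in> range elts"
  shows "X \<union> Y \<in> range (elts :: 'v::zfc_universe \<Rightarrow> 'v set)"
proof -
  from assms obtain x y where [simp]: "X = elts x" "Y = elts y" by auto
  have "\<Union> (elts ` {x, y}) \<in> range elts"
    by (intro elts_Union vset_finite) simp
  then show ?thesis by simp
qed

lemma mem_induct [case_names mem]:
  assumes "\<And>x::'v::zfc_universe. (\<And>y. y \<in> elts x \<Longrightarrow> P y) \<Longrightarrow> P x"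
  shows "P x"
  using elts_foundation by (rule wf_induct_rule) (use assms in auto)

lemma mem_irrefl [simp]: "(x::'v::zfc_universe) \<notin> elts x"
  by (induction x rule: mem_induct) blast

section \<open>Ordinals and cardinals\<close>

lemma ordinal_trans: "ordinal \<alpha> \<Longrightarrow> \<beta> \<in> elts \<alpha> \<Longrightarrow> \<gamma> \<in> elts \<beta> \<Longrightarrow> \<gamma> \<in> elts \<alpha>"
  unfolding ordinal_def transitive_class_def by blast

lemma ordinal_mem: "ordinal \<alpha> \<Longrightarrow> \<beta> \<in> elts \<alpha> \<Longrightarrow> ordinal \<beta>"
  unfolding ordinal_def transitive_class_def by blast

lemma ordinalI:
  assumes "\<And>\<beta>. \<beta> \<in> elts \<alpha> \<Longrightarrow> ordinal \<beta>"
    and "\<And>\<beta> \<gamma>. \<beta> \<in> elts \<alpha> \<Longrightarrow> \<gamma> \<in> elts \<beta> \<Longrightarrow> \<gamma> \<in> elts \<alpha>"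
  shows "ordinal \<alpha>"
  using assms unfolding ordinal_def transitive_class_def by blast

text \<open>Double membership induction: if neither ordinal is an element of the other, comparing
  each element of one with the other ordinal shows that both have the same elements.\<close>

lemma ordinal_linear:
  "ordinal \<alpha> \<Longrightarrow> ordinal \<beta> \<Longrightarrow> \<alpha> \<in> elts \<beta> \<or> \<alpha> = \<beta> \<or> \<beta> \<in> elts \<alpha>"
proof (induction \<alpha> arbitrary: \<beta> rule: mem_induct)
  case (mem \<alpha>)
  note outer = mem
  from outer(3) show ?case
  proof (induction \<beta> rule: mem_induct)
    case (mem \<beta>)
    have "elts \<alpha> = elts \<beta>" if "\<alpha> \<notin> elts \<beta>" "\<beta> \<notin> elts \<alpha>"
    proof (intro set_eqI iffI)
      fix \<gamma> assume \<gamma>: "\<gamma> \<in> elts \<alpha>"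
      with outer ordinal_mem mem.prems have "\<gamma> \<in> elts \<beta> \<or> \<gamma> = \<beta> \<or> \<beta> \<in> elts \<gamma>" by blast
      with that \<gamma> outer(2) show "\<gamma> \<in> elts \<beta>" by (meson ordinal_trans)
    next
      fix \<gamma> assume \<gamma>: "\<gamma> \<in> elts \<beta>"
      with mem ordinal_mem have "\<alpha> \<in> elts \<gamma> \<or> \<alpha> = \<gamma> \<or> \<gamma> \<in> elts \<alpha>" by blast
      with that \<gamma> mem.prems show "\<gamma> \<in> elts \<alpha>" by (meson ordinal_trans)
    qed
    then show ?case using elts_ext by blast
  qed
qed

lemma ordinal_subset:
  assumes "ordinal \<alpha>" "ordinal \<beta>" "\<beta> \<notin> elts \<alpha>"
  shows "elts \<alpha> \<subseteq> elts \<beta>"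
  using ordinal_linear[OF assms(1,2)] assms(3) ordinal_trans[OF assms(2)] by auto

lemma ordinal_minimal:
  assumes "ordinal \<alpha>" "P \<alpha>"
  shows "\<exists>\<mu>. ordinal \<mu> \<and> P \<mu> \<and> (\<forall>\<beta>\<in>elts \<mu>. \<not> P \<beta>) \<and> \<alpha> \<notin> elts \<mu>"
proof -
  obtain \<mu> where "ordinal \<mu> \<and> P \<mu>" "\<And>\<beta>. \<beta> \<in> elts \<mu> \<Longrightarrow> \<not> (ordinal \<beta> \<and> P \<beta>)"
    using wfE_min[OF elts_foundation, of \<alpha> "{\<beta>. ordinal \<beta> \<and> P \<beta>}"] assms by auto
  with assms ordinal_mem show ?thesis by blast
qed

lemma lepoll_total: "A \<lesssim> B \<or> B \<lesssim> A"
  unfolding lepoll_def card_of_ordLeq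
  by (rule ordLeq_total[OF card_of_Well_order card_of_Well_order])

lemma Burali_Forti: "{\<alpha>::'v::zfc_universe. ordinal \<alpha>} \<notin> range elts"
proof
  assume "{\<alpha>::'v. ordinal \<alpha>} \<in> range elts"
  then obtain \<omega> :: 'v where \<omega>: "elts \<omega> = {\<alpha>. ordinal \<alpha>}" by auto
  have "ordinal \<omega>"
    by (rule ordinalI; unfold \<omega> mem_Collect_eq) (use ordinal_mem in blast)+
  with \<omega> have "\<omega> \<in> elts \<omega>" by simp
  then show False by simp
qed

text \<open>The ordinals form a proper class, so by Replacement they do not inject into
  \<open>elts x\<close>; comparability of cardinalities then injects \<open>elts x\<close> into the
  ordinals. The image of this injection, together with the elements of its members, makes up the
  ordinal \<open>\<delta>\<close>.\<close>

lemma lepoll_ordinal: "\<exists>\<delta>::'v. ordinal \<delta> \<and> elts (x::'v::zfc_universe) \<lesssim> elts \<delta>"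
proof -
  have "\<not> {\<alpha>::'v. ordinal \<alpha>} \<lesssim> elts x"
  proof
    assume "{\<alpha>::'v. ordinal \<alpha>} \<lesssim> elts x"
    then obtain g where "{\<alpha>::'v. ordinal \<alpha>} \<subseteq> g ` elts x" by (auto simp: lepoll_iff)
    then have "{\<alpha>::'v. ordinal \<alpha>} \<in> range elts"
      by (metis elts_down elts_image_set)
    with Burali_Forti show False by blast
  qed
  then have "elts x \<lesssim> {\<alpha>::'v. ordinal \<alpha>}" using lepoll_total by blast
  then obtain h where h: "inj_on h (elts x)" "h ` elts x \<subseteq> {\<alpha>::'v. ordinal \<alpha>}"
    unfolding lepoll_def by blast
  let ?H = "h ` elts x"
  have "\<Union> (elts ` ?H) \<union> ?H \<in> range elts"
    by (intro small_Un elts_Union elts_replacement rangeI)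
  then obtain \<delta> where \<delta>: "elts \<delta> = \<Union> (elts ` ?H) \<union> ?H" by (metis rangeE)
  have "ordinal \<delta>"
  proof (rule ordinalI)
    fix \<beta> assume "\<beta> \<in> elts \<delta>"
    then consider "\<beta> \<in> ?H" | \<eta> where "\<eta> \<in> ?H" "\<beta> \<in> elts \<eta>" by (auto simp: \<delta>)
    note \<beta> = this
    from \<beta> show "ordinal \<beta>"
      by cases (use h(2) ordinal_mem in blast)+
    fix \<gamma> assume \<gamma>: "\<gamma> \<in> elts \<beta>"
    from \<beta> show "\<gamma> \<in> elts \<delta>"
    proof cases
      case 2
      then have "\<gamma> \<in> elts \<eta>" using h(2) \<gamma> ordinal_trans by blast
      with 2 show ?thesis by (auto simp: \<delta>)
    qed (use \<gamma> in \<open>auto simp: \<delta>\<close>)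
  qed
  moreover have "elts x \<lesssim> elts \<delta>" using h(1) \<delta> unfolding lepoll_def by blast
  ultimately show ?thesis by blast
qed

text \<open>Replacement turns every HOL bijection between sets into a set function, so cardinality
  can be measured by \<open>\<approx>\<close> from here on.\<close>

lemma cardinal_in_UNIV:
  "cardinal_in UNIV \<alpha> \<longleftrightarrow> ordinal \<alpha> \<and> (\<forall>\<beta>\<in>elts \<alpha>. \<not> elts \<beta> \<approx> elts \<alpha>)"
proof -
  have "(\<exists>f. function_on \<beta> f \<and> bij_betw (app f) (elts \<beta>) (elts \<alpha>)) \<longleftrightarrow> elts \<beta> \<approx> elts \<alpha>"
    for \<beta> :: 'a
  proof
    assume "elts \<beta> \<approx> elts \<alpha>"
    then obtain h where h: "bij_betw h (elts \<beta>) (elts \<alpha>)" by (auto simp: eqpoll_def)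
    then have "bij_betw (app (fun_graph \<beta> h)) (elts \<beta>) (elts \<alpha>)"
      by (subst bij_betw_cong[of _ _ h]) (simp_all add: app_fun_graph)
    then show "\<exists>f. function_on \<beta> f \<and> bij_betw (app f) (elts \<beta>) (elts \<alpha>)"
      unfolding function_on_def by blast
  qed (auto simp: eqpoll_def)
  then show ?thesis by (simp add: cardinal_in_def)
qed

text \<open>The least ordinal \<open>\<delta>\<close> into which the power set of
  \<open>\<kappa>\<close> injects is a cardinal, and by Cantor's theorem it is not contained in
  \<open>\<kappa>\<close>.\<close>

lemma ex_cardinal_above:
  assumes "ordinal (\<kappa>::'v::zfc_universe)"
  shows "\<exists>\<delta>. cardinal_in UNIV \<delta> \<and> \<kappa> \<in> elts \<delta>"
proof -
  obtain p where p: "elts p = {y. elts y \<subseteq> elts \<kappa>}" using elts_Pow[of \<kappa>] by auto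
  obtain \<alpha> :: 'v where \<alpha>: "ordinal \<alpha>" "elts p \<lesssim> elts \<alpha>" using lepoll_ordinal by blast
  obtain \<delta> :: 'v where \<delta>: "ordinal \<delta>" "elts p \<lesssim> elts \<delta>"
    "\<And>\<beta>. \<beta> \<in> elts \<delta> \<Longrightarrow> \<not> elts p \<lesssim> elts \<beta>"
    using ordinal_minimal[of \<alpha> "\<lambda>\<alpha>. elts p \<lesssim> elts \<alpha>"] \<alpha> by blast
  then have "cardinal_in UNIV \<delta>"
    unfolding cardinal_in_UNIV by (meson eqpoll_imp_lepoll eqpoll_sym lepoll_trans)
  moreover have "Pow (elts \<kappa>) \<lesssim> elts p"
    unfolding lepoll_def p
    by (intro exI[of _ vset]) (auto simp: small_subset intro!: inj_onI dest: arg_cong[of _ _ elts])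
  then have "\<not> elts p \<lesssim> elts \<kappa>"
    using lesspoll_Pow_self[of "elts \<kappa>"] by (meson lepoll_trans lesspoll_def lepoll_antisym)
  then have "\<not> elts \<delta> \<subseteq> elts \<kappa>"
    using \<delta>(2) by (meson lepoll_trans subset_imp_lepoll)
  then have "\<kappa> \<in> elts \<delta>" using ordinal_subset[OF \<delta>(1) assms] by blast
  ultimately show ?thesis by blast
qed

text \<open>Justifies the definite description: a least cardinal above \<open>\<kappa>\<close>
  exists, and linearity makes it unique.\<close>

lemma succ_cardinal:
  assumes "ordinal (\<kappa>::'v::zfc_universe)"
  shows "cardinal_in UNIV (succ_cardinal \<kappa>) \<and> \<kappa> \<in> elts (succ_cardinal \<kappa>) \<and>
    (\<forall>\<mu>\<in>elts (succ_cardinal \<kappa>). cardinal_in UNIV \<mu> \<longrightarrow> \<kappa> \<notin> elts \<mu>)"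
proof -
  let ?P = "\<lambda>\<theta>. cardinal_in UNIV \<theta> \<and> \<kappa> \<in> elts \<theta>"
  obtain \<delta> where "?P \<delta>" using ex_cardinal_above[OF assms] by blast
  then obtain \<theta> where \<theta>: "ordinal \<theta>" "?P \<theta>" "\<And>\<mu>. \<mu> \<in> elts \<theta> \<Longrightarrow> \<not> ?P \<mu>"
    using ordinal_minimal[of \<delta> ?P] by (auto simp: cardinal_in_UNIV)
  show ?thesis
    unfolding succ_cardinal_in_def
  proof (rule theI[of _ \<theta>])
    fix \<theta>' assume "cardinal_in UNIV \<theta>' \<and> \<kappa> \<in> elts \<theta>' \<and>
      (\<forall>\<mu>\<in>elts \<theta>'. cardinal_in UNIV \<mu> \<longrightarrow> \<kappa> \<notin> elts \<mu>)"
    with \<theta> ordinal_linear[of \<theta> \<theta>'] show "\<theta>' = \<theta>" by (auto simp: cardinal_in_UNIV)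
  qed (use \<theta> in auto)
qed

text \<open>The least ordinal \<open>\<mu>\<close> equinumerous with \<open>\<alpha>\<close> is a
  cardinal below \<open>\<kappa>\<^sup>+\<close>, hence at most \<open>\<kappa>\<close>.\<close>

lemma mem_succ_cardinal_lepoll:
  assumes "ordinal \<kappa>" "\<alpha> \<in> elts (succ_cardinal \<kappa>)"
  shows "elts \<alpha> \<lesssim> elts \<kappa>"
proof -
  note \<theta> = succ_cardinal[OF assms(1)]
  then have ord: "ordinal (succ_cardinal \<kappa>)" by (simp add: cardinal_in_UNIV)
  obtain \<mu> where \<mu>: "ordinal \<mu>" "elts \<mu> \<approx> elts \<alpha>" "\<And>\<beta>. \<beta> \<in> elts \<mu> \<Longrightarrow> \<not> elts \<beta> \<approx> elts \<alpha>"
    "\<alpha> \<notin> elts \<mu>"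
    using ordinal_minimal[of \<alpha> "\<lambda>\<beta>. elts \<beta> \<approx> elts \<alpha>"] ordinal_mem[OF ord assms(2)] by blast
  have "cardinal_in UNIV \<mu>"
    unfolding cardinal_in_UNIV using \<mu> by (meson eqpoll_trans)
  moreover have "\<mu> \<in> elts (succ_cardinal \<kappa>)"
    using ordinal_linear[OF \<mu>(1) ordinal_mem[OF ord assms(2)]] \<mu>(4) assms(2) ord
    by (meson ordinal_trans)
  ultimately have "elts \<mu> \<subseteq> elts \<kappa>"
    using \<theta> ordinal_subset[OF \<mu>(1) assms(1)] by blast
  with \<mu>(2) show ?thesis
    by (meson eqpoll_sym lepoll_trans1 subset_imp_lepoll)
qed

text \<open>Otherwise the least well-order of \<open>Pow \<kappa>\<close> would be isomorphic to a proper initial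
  segment of \<open>\<kappa>\<^sup>+\<close>, that is, to an ordinal of size at most \<open>\<kappa>\<close>.\<close>

lemma succ_cardinal_lepoll_Pow:
  assumes "ordinal (\<kappa>::'v::zfc_universe)"
  shows "elts (succ_cardinal \<kappa>) \<lesssim> Pow (elts \<kappa>)"
proof (rule ccontr)
  assume neg: "\<not> elts (succ_cardinal \<kappa>) \<lesssim> Pow (elts \<kappa>)"
  let ?S = "elts (succ_cardinal \<kappa>)"
  let ?P = "Pow (elts \<kappa>)"
  have ord: "ordinal (succ_cardinal \<kappa>)"
    using succ_cardinal[OF assms] by (simp add: cardinal_in_UNIV)
  define r where "r = {(\<alpha>, \<beta>). \<alpha> \<in> ?S \<and> \<beta> \<in> ?S \<and> (\<alpha> = \<beta> \<or> \<alpha> \<in> elts \<beta>)}"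
  have fld: "Field r = ?S" by (auto simp: r_def Field_def)
  have "wf (r - Id)"
    by (rule wf_subset[OF elts_foundation]) (auto simp: r_def)
  moreover have "trans r" using ordinal_trans ordinal_mem[OF ord]
    by (auto simp: r_def intro!: transI)
  moreover have "antisym r"
  proof (rule antisymI)
    fix \<alpha> \<beta> assume "(\<alpha>, \<beta>) \<in> r" "(\<beta>, \<alpha>) \<in> r"
    then show "\<alpha> = \<beta>"
      using ordinal_trans[OF ordinal_mem[OF ord, of \<alpha>], of \<beta> \<alpha>] by (auto simp: r_def)
  qed
  moreover have "total_on ?S r"
  proof (rule total_onI)
    fix \<alpha> \<beta> assume "\<alpha> \<in> ?S" "\<beta> \<in> ?S"
    then show "(\<alpha>, \<beta>) \<in> r \<or> (\<beta>, \<alpha>) \<in> r"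
      using ordinal_linear[of \<alpha> \<beta>] ordinal_mem[OF ord] by (auto simp: r_def)
  qed
  moreover have "refl_on ?S r" by (auto simp: r_def refl_on_def)
  moreover have "r \<subseteq> ?S \<times> ?S" by (auto simp: r_def)
  ultimately have wo: "well_order_on ?S r"
    by (simp add: well_order_on_def linear_order_on_def partial_order_on_def preorder_on_def)
  have "(card_of ?P, card_of ?S) \<in> ordLess"
    using neg unfolding lepoll_def card_of_ordLeq
    by (meson card_of_Well_order not_ordLeq_iff_ordLess)
  moreover have "(card_of ?S, r) \<in> ordLeq" using wo by (rule card_of_least)
  ultimately have "(card_of ?P, r) \<in> ordLess" by (rule ordLess_ordLeq_trans)
  then obtain \<alpha> where \<alpha>: "\<alpha> \<in> ?S" and iso: "(card_of ?P, Restr r (underS r \<alpha>)) \<in> ordIso"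
    using ordLess_iff_ordIso_Restr[of r "card_of ?P"] wo card_of_Well_order fld by auto
  then obtain f where "iso (card_of ?P) (Restr r (underS r \<alpha>)) f"
    unfolding ordIso_def by auto
  then have "bij_betw f (Field (card_of ?P)) (Field (Restr r (underS r \<alpha>)))"
    by (simp add: iso_def)
  moreover have "Field (Restr r (underS r \<alpha>)) \<subseteq> elts \<alpha>"
    by (auto simp: Field_def underS_def r_def)
  ultimately have "?P \<lesssim> elts \<alpha>"
    unfolding bij_betw_def lepoll_def Field_card_of by metis
  also have "elts \<alpha> \<lesssim> elts \<kappa>" using mem_succ_cardinal_lepoll[OF assms \<alpha>] .
  finally show False
    using lesspoll_Pow_self[of "elts \<kappa>"] lepoll_antisym[of "elts \<kappa>" ?P]
    by (simp add: lesspoll_def)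
qed

section \<open>Formulas\<close>

definition Imp :: "fm \<Rightarrow> fm \<Rightarrow> fm" where
  "Imp p q = Neg (Conj p (Neg q))"

definition Iff :: "fm \<Rightarrow> fm \<Rightarrow> fm" where
  "Iff p q = Conj (Imp p q) (Imp q p)"

definition Disj :: "fm \<Rightarrow> fm \<Rightarrow> fm" where
  "Disj p q = Imp (Neg p) q"

definition Ex :: "nat \<Rightarrow> fm \<Rightarrow> fm" where
  "Ex n p = Neg (Forall n (Neg p))"

definition BAll :: "nat \<Rightarrow> nat \<Rightarrow> fm \<Rightarrow> fm" where
  "BAll n m p = Forall n (Imp (Mem n m) p)"

definition BEx :: "nat \<Rightarrow> nat \<Rightarrow> fm \<Rightarrow> fm" where
  "BEx n m p = Neg (BAll n m (Neg p))"

lemma sat_connectives [simp]: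
  "sat N s (Imp p q) \<longleftrightarrow> (sat N s p \<longrightarrow> sat N s q)"
  "sat N s (Iff p q) \<longleftrightarrow> (sat N s p \<longleftrightarrow> sat N s q)"
  "sat N s (Disj p q) \<longleftrightarrow> (sat N s p \<or> sat N s q)"
  "sat N s (Ex n p) \<longleftrightarrow> (\<exists>a\<in>N. sat N (s(n := a)) p)"
  by (auto simp: Imp_def Iff_def Disj_def Ex_def)

lemma sat_bounded [simp]:
  assumes "n \<noteq> m"
  shows "sat N s (BAll n m p) \<longleftrightarrow> (\<forall>a\<in>N \<inter> elts (s m). sat N (s(n := a)) p)"
    and "sat N s (BEx n m p) \<longleftrightarrow> (\<exists>a\<in>N \<inter> elts (s m). sat N (s(n := a)) p)"
  using assms by (auto simp: BAll_def BEx_def)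

text \<open>\<open>(x, y) \<in> F\<close>; the variables \<open>10\<close>, \<open>11\<close>, \<open>12\<close> are auxiliary.\<close>

definition Rel :: "nat \<Rightarrow> nat \<Rightarrow> nat \<Rightarrow> fm" where
  "Rel F x y = BEx 10 F
    (Conj (BEx 11 10 (Conj (Mem x 11) (BAll 12 11 (Eq 12 x))))
    (Conj (BEx 11 10 (Conj (Mem x 11) (Conj (Mem y 11) (BAll 12 11 (Disj (Eq 12 x) (Eq 12 y))))))
      (BAll 11 10 (Disj (Conj (Mem x 11) (BAll 12 11 (Eq 12 x)))
        (Conj (Mem x 11) (Conj (Mem y 11) (BAll 12 11 (Disj (Eq 12 x) (Eq 12 y)))))))))"

lemma elts_finite [simp]:
  "elts (vset {a}) = {a}" "elts (vset {a, b}) = {a, b}" "elts (vset {}) = {}"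
  by (intro elts_vset vset_finite; simp)+

lemma elts_vpair: "elts (vpair x y) = {vset {x}, vset {x, y}}"
  by (simp add: vpair_def)

lemma elts_eq_iff: "elts x = elts y \<longleftrightarrow> x = (y::'v::zfc_universe)"
  using elts_ext by auto

text \<open>All quantifiers of \<open>Rel\<close> are bounded, so a transitive class evaluates it
  correctly. The bounds \<open>< 10\<close> keep \<open>F\<close>, \<open>x\<close> and
  \<open>y\<close> apart from the auxiliary variables.\<close>

lemma sat_Rel [simp]:
  assumes N: "transitive_class N" and F: "s F \<in> N" and "F < 10" "x < 10" "y < 10"
  shows "sat N s (Rel F x y) \<longleftrightarrow> vpair (s x) (s y) \<in> elts (s F)"
proof -
  have *: "N \<inter> elts u = elts u" if "u \<in> N" for u
    using N that by (auto simp: transitive_class_def)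
  have **: "u \<in> N" if "u \<in> elts p" "p \<in> N" for u p
    using N that by (auto simp: transitive_class_def)
  have sg: "a \<in> elts u \<and> (\<forall>v\<in>elts u. v = a) \<longleftrightarrow> u = vset {a}" for a u :: 'a
    by (auto simp flip: elts_eq_iff)
  have db: "a \<in> elts u \<and> b \<in> elts u \<and> (\<forall>v\<in>elts u. v = a \<or> v = b) \<longleftrightarrow> u = vset {a, b}"
    for a b u :: 'a
    by (auto simp flip: elts_eq_iff)
  have pr: "(\<exists>u\<in>elts p. u = vset {a}) \<and> (\<exists>u\<in>elts p. u = vset {a, b}) \<and>
      (\<forall>u\<in>elts p. u = vset {a} \<or> u = vset {a, b}) \<longleftrightarrow> p = vpair a b" for a b p :: 'a
    by (auto simp: elts_vpair simp flip: elts_eq_iff[of p])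
  have "sat N s (Rel F x y) \<longleftrightarrow> (\<exists>p\<in>elts (s F).
     (\<exists>u\<in>elts p. s x \<in> elts u \<and> (\<forall>v\<in>elts u. v = s x)) \<and>
     (\<exists>u\<in>elts p. s x \<in> elts u \<and> s y \<in> elts u \<and> (\<forall>v\<in>elts u. v = s x \<or> v = s y)) \<and>
     (\<forall>u\<in>elts p. (s x \<in> elts u \<and> (\<forall>v\<in>elts u. v = s x)) \<or>
        (s x \<in> elts u \<and> s y \<in> elts u \<and> (\<forall>v\<in>elts u. v = s x \<or> v = s y))))"
    unfolding Rel_def using assms by (simp add: * **[OF _ F] ** cong: conj_cong)
  also have "\<dots> \<longleftrightarrow> (\<exists>p\<in>elts (s F). p = vpair (s x) (s y))"
    unfolding sg db pr ..
  finally show ?thesis by blast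
qed

section \<open>Elementary embeddings with a critical point\<close>

locale embedding =
  fixes j :: "'v::zfc_universe \<Rightarrow> 'v" and M :: "'v set" and \<kappa> :: 'v
  assumes trans_M: "transitive_class M"
    and elem: "elementary_embedding j UNIV M"
    and crit: "critical_point j \<kappa>"
begin

lemma trans_UNIV: "transitive_class UNIV"
  by (simp add: transitive_class_def)

lemma j_M [simp]: "j x \<in> M"
  using elem unfolding elementary_embedding_def by blast

lemma M_trans: "x \<in> M \<Longrightarrow> y \<in> elts x \<Longrightarrow> y \<in> M"
  using trans_M unfolding transitive_class_def by auto

lemma M_Int [simp]: "x \<in> M \<Longrightarrow> M \<inter> elts x = elts x"
  using M_trans by auto

text \<open>Elementarity for up to four parameters, held by the variables 0 to 3. Every further
  variable defaults to the last parameter; the formulas used later bind theirs, numbered from 4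
  on.\<close>

lemma transfer:
  fixes p :: fm
  shows "sat UNIV (\<lambda>n. if n = 0 then a else if n = 1 then b else if n = 2 then c else d) p \<longleftrightarrow>
    sat M (\<lambda>n. if n = 0 then j a else if n = 1 then j b else if n = 2 then j c else j d) p"
proof -
  let ?s = "\<lambda>n::nat. if n = 0 then a else if n = 1 then b else if n = 2 then c else d"
  have "j \<circ> ?s = (\<lambda>n. if n = 0 then j a else if n = 1 then j b else if n = 2 then j c else j d)"
    by auto
  moreover have "sat UNIV ?s p \<longleftrightarrow> sat M (j \<circ> ?s) p"
    using elem unfolding elementary_embedding_def by blast
  ultimately show ?thesis by simp
qed

lemma j_mem [simp]: "j x \<in> elts (j y) \<longleftrightarrow> x \<in> elts y"
  using transfer[of x y _ _ "Mem 0 1"] by simp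

lemma j_eq [simp]: "j x = j y \<longleftrightarrow> x = y"
  using transfer[of x y _ _ "Eq 0 1"] by simp

lemma j_subset: "elts (j x) \<subseteq> elts (j y) \<longleftrightarrow> elts x \<subseteq> elts y"
  using transfer[of x y _ _ "BAll 4 0 (Mem 4 1)"] by (simp add: subset_eq)

lemma j_vpair [simp]: "vpair (j x) (j y) \<in> elts (j F) \<longleftrightarrow> vpair x y \<in> elts F"
  using transfer[of F x y _ "Rel 0 1 2"] by (simp add: trans_M trans_UNIV)

end

section \<open>Complete ultrafilters as predicates\<close>

text \<open>Stated for HOL sets instead of elements of the universe, which spares
  \<open>vset\<close> and \<open>elts\<close> in each axiom. Only the values of \<open>F\<close> on
  subsets of \<open>elts \<kappa>\<close> matter.\<close>

definition complete_uf :: "'v::zfc_universe \<Rightarrow> ('v set \<Rightarrow> bool) \<Rightarrow> bool" where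
  "complete_uf \<kappa> F \<longleftrightarrow> F (elts \<kappa>) \<and> \<not> F {} \<and>
     (\<forall>X Y. F X \<and> X \<subseteq> Y \<and> Y \<subseteq> elts \<kappa> \<longrightarrow> F Y) \<and>
     (\<forall>X Y. X \<subseteq> elts \<kappa> \<and> Y \<subseteq> elts \<kappa> \<and> F X \<and> F Y \<longrightarrow> F (X \<inter> Y)) \<and>
     (\<forall>X. X \<subseteq> elts \<kappa> \<longrightarrow> F X \<or> F (elts \<kappa> - X)) \<and>
     (\<forall>\<gamma>\<in>elts \<kappa>. \<forall>A. (\<forall>\<alpha>\<in>elts \<gamma>. A \<alpha> \<subseteq> elts \<kappa> \<and> F (A \<alpha>)) \<longrightarrow>
        F {\<xi> \<in> elts \<kappa>. \<forall>\<alpha>\<in>elts \<gamma>. \<xi> \<in> A \<alpha>})"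

lemma complete_ufD:
  assumes "complete_uf \<kappa> F"
  shows "F (elts \<kappa>)" "\<not> F {}"
    "F X \<Longrightarrow> X \<subseteq> Y \<Longrightarrow> Y \<subseteq> elts \<kappa> \<Longrightarrow> F Y"
    "X \<subseteq> elts \<kappa> \<Longrightarrow> Y \<subseteq> elts \<kappa> \<Longrightarrow> F X \<Longrightarrow> F Y \<Longrightarrow> F (X \<inter> Y)"
    "X \<subseteq> elts \<kappa> \<Longrightarrow> F X \<or> F (elts \<kappa> - X)"
    "\<gamma> \<in> elts \<kappa> \<Longrightarrow> (\<And>\<alpha>. \<alpha> \<in> elts \<gamma> \<Longrightarrow> A \<alpha> \<subseteq> elts \<kappa> \<and> F (A \<alpha>)) \<Longrightarrow>
      F {\<xi> \<in> elts \<kappa>. \<forall>\<alpha>\<in>elts \<gamma>. \<xi> \<in> A \<alpha>}"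
proof -
  note F = assms[unfolded complete_uf_def]
  show "F (elts \<kappa>)" "\<not> F {}" using F by simp_all
  show "F X \<Longrightarrow> X \<subseteq> Y \<Longrightarrow> Y \<subseteq> elts \<kappa> \<Longrightarrow> F Y"
    using F[THEN conjunct2, THEN conjunct2, THEN conjunct1, THEN spec, THEN spec, of X Y] by simp
  show "X \<subseteq> elts \<kappa> \<Longrightarrow> Y \<subseteq> elts \<kappa> \<Longrightarrow> F X \<Longrightarrow> F Y \<Longrightarrow> F (X \<inter> Y)"
    using F[THEN conjunct2, THEN conjunct2, THEN conjunct2, THEN conjunct1, THEN spec, THEN spec,
        of X Y] by simp
  show "X \<subseteq> elts \<kappa> \<Longrightarrow> F X \<or> F (elts \<kappa> - X)"
    using F[THEN conjunct2, THEN conjunct2, THEN conjunct2, THEN conjunct2, THEN conjunct1,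
        THEN spec, of X] by simp
  show "\<gamma> \<in> elts \<kappa> \<Longrightarrow> (\<And>\<alpha>. \<alpha> \<in> elts \<gamma> \<Longrightarrow> A \<alpha> \<subseteq> elts \<kappa> \<and> F (A \<alpha>)) \<Longrightarrow>
      F {\<xi> \<in> elts \<kappa>. \<forall>\<alpha>\<in>elts \<gamma>. \<xi> \<in> A \<alpha>}"
    using F[THEN conjunct2, THEN conjunct2, THEN conjunct2, THEN conjunct2, THEN conjunct2,
        THEN bspec, of \<gamma>] by blast
qed

lemma vset_elts [simp]: "vset (elts x) = x"
  by (rule elts_ext) (simp add: elts_vset)

lemma complete_uf_of_ultrafilter:
  assumes "complete_ultrafilter_over \<kappa> W"
  shows "complete_uf \<kappa> (\<lambda>X. X \<subseteq> elts \<kappa> \<and> vset X \<in> elts W)"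
proof -
  note W = assms[unfolded complete_ultrafilter_over_def ultrafilter_over_def]
  have up: "\<And>X Y. X \<in> elts W \<Longrightarrow> elts X \<subseteq> elts Y \<Longrightarrow> elts Y \<subseteq> elts \<kappa> \<Longrightarrow> Y \<in> elts W"
    and int: "\<And>X Y. X \<in> elts W \<Longrightarrow> Y \<in> elts W \<Longrightarrow> vset (elts X \<inter> elts Y) \<in> elts W"
    and com: "\<And>X. elts X \<subseteq> elts \<kappa> \<Longrightarrow> X \<in> elts W \<or> vset (elts \<kappa> - elts X) \<in> elts W"
    and cpl: "\<And>\<gamma> A. \<gamma> \<in> elts \<kappa> \<Longrightarrow> A ` elts \<gamma> \<subseteq> elts W \<Longrightarrow> vInter \<kappa> \<gamma> A \<in> elts W"
    using W by blast+
  have "\<kappa> \<in> elts W" "vset {} \<notin> elts W" using W by blast+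
  note W' = this
  show ?thesis
    unfolding complete_uf_def
  proof (intro conjI allI ballI impI; (elim conjE)?)
    fix X Y assume "X \<subseteq> elts \<kappa>" "vset X \<in> elts W" "X \<subseteq> Y" "Y \<subseteq> elts \<kappa>"
    then show "vset Y \<in> elts W"
      using up[of "vset X" "vset Y"] by (simp add: small_subset)
  next
    fix X Y assume "X \<subseteq> elts \<kappa>" "Y \<subseteq> elts \<kappa>" "vset X \<in> elts W" "vset Y \<in> elts W"
    then show "vset (X \<inter> Y) \<in> elts W"
      using int[of "vset X" "vset Y"] by (simp add: small_subset)
  next
    fix X assume "X \<subseteq> elts \<kappa>"
    then show "X \<subseteq> elts \<kappa> \<and> vset X \<in> elts W \<or>
        elts \<kappa> - X \<subseteq> elts \<kappa> \<and> vset (elts \<kappa> - X) \<in> elts W"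
      using com[of "vset X"] by (simp add: small_subset)
  next
    fix \<gamma> and A :: "'a \<Rightarrow> 'a set"
    assume \<gamma>: "\<gamma> \<in> elts \<kappa>"
      and A: "\<forall>\<alpha>\<in>elts \<gamma>. A \<alpha> \<subseteq> elts \<kappa> \<and> A \<alpha> \<subseteq> elts \<kappa> \<and> vset (A \<alpha>) \<in> elts W"
    have "elts (vset (A \<alpha>)) = A \<alpha>" if "\<alpha> \<in> elts \<gamma>" for \<alpha>
      using A that small_subset by blast
    then have "vInter \<kappa> \<gamma> (\<lambda>\<alpha>. vset (A \<alpha>)) = vset {\<xi> \<in> elts \<kappa>. \<forall>\<alpha>\<in>elts \<gamma>. \<xi> \<in> A \<alpha>}"
      unfolding vInter_def by simp
    with cpl[OF \<gamma>, of "\<lambda>\<alpha>. vset (A \<alpha>)"] A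
    show "vset {\<xi> \<in> elts \<kappa>. \<forall>\<alpha>\<in>elts \<gamma>. \<xi> \<in> A \<alpha>} \<in> elts W" by auto
  qed (use W' in auto)
qed

lemma elts_family:
  "elts (vset {X. elts X \<subseteq> elts \<kappa> \<and> P X}) = {X. elts X \<subseteq> elts \<kappa> \<and> P X}"
proof -
  obtain p where "elts p = {X. elts X \<subseteq> elts \<kappa>}" using elts_Pow[of \<kappa>] by auto
  then show ?thesis by (intro small_subset[of _ p]) auto
qed

lemma ultrafilter_of_complete_uf:
  assumes "complete_uf \<kappa> F"
  shows "complete_ultrafilter_over \<kappa> (vset {X. elts X \<subseteq> elts \<kappa> \<and> F (elts X)})"
proof -
  have sub: "elts (vset (elts \<kappa> - X)) = elts \<kappa> - X" "elts (vset (elts a \<inter> X)) = elts a \<inter> X" for X a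
    by (rule small_subset[of _ \<kappa>], blast) (rule small_subset[of _ a], blast)
  note F = complete_ufD[OF assms]
  show ?thesis
    unfolding complete_ultrafilter_over_def ultrafilter_over_def elts_family mem_Collect_eq
  proof (intro conjI allI ballI impI; (elim conjE)?)
    fix \<gamma> A assume \<gamma>: "\<gamma> \<in> elts \<kappa>" and A: "A ` elts \<gamma> \<subseteq> {X. elts X \<subseteq> elts \<kappa> \<and> F (elts X)}"
    have *: "elts (vInter \<kappa> \<gamma> A) = {\<xi> \<in> elts \<kappa>. \<forall>\<alpha>\<in>elts \<gamma>. \<xi> \<in> elts (A \<alpha>)}"
      unfolding vInter_def by (rule small_subset[of _ \<kappa>]) auto
    then show "elts (vInter \<kappa> \<gamma> A) \<subseteq> elts \<kappa>" by auto
    show "F (elts (vInter \<kappa> \<gamma> A))"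
      unfolding * by (rule F(6)[OF \<gamma>]) (use A in blast)
  next
    fix X Y assume "X \<in> {X. elts X \<subseteq> elts \<kappa> \<and> F (elts X)}" "elts X \<subseteq> elts Y" "elts Y \<subseteq> elts \<kappa>"
    then show "F (elts Y)" using F(3)[of "elts X" "elts Y"] by blast
  qed (use F(1,2,4,5) in \<open>auto simp: sub\<close>)
qed

text \<open>This is the Rudin-Keisler image of \<open>F\<close> under \<open>\<phi>\<close>;
  preimages commute with intersections and complements, so each axiom is inherited.\<close>

lemma complete_uf_vimage:
  assumes F: "complete_uf \<kappa> F" and \<phi>: "\<And>\<xi>. \<xi> \<in> elts \<kappa> \<Longrightarrow> \<phi> \<xi> \<in> elts \<kappa>"
  shows "complete_uf \<kappa> (\<lambda>X. F {\<xi> \<in> elts \<kappa>. \<phi> \<xi> \<in> X})"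
proof -
  note F' = complete_ufD[OF F]
  let ?v = "\<lambda>X. {\<xi> \<in> elts \<kappa>. \<phi> \<xi> \<in> X}"
  show ?thesis
    unfolding complete_uf_def
  proof (intro conjI allI ballI impI; (elim conjE)?)
    have "?v (elts \<kappa>) = elts \<kappa>" using \<phi> by auto
    then show "F (?v (elts \<kappa>))" using F'(1) by simp
  next
    fix X Y assume "F (?v X)" "X \<subseteq> Y" then show "F (?v Y)"
      by (elim F'(3)) auto
  next
    fix X Y assume "F (?v X)" "F (?v Y)"
    then have "F (?v X \<inter> ?v Y)" by (intro F'(4)) auto
    also have "?v X \<inter> ?v Y = ?v (X \<inter> Y)" by auto
    finally show "F (?v (X \<inter> Y))" .
  next
    fix X
    have "elts \<kappa> - ?v X = ?v (elts \<kappa> - X)" using \<phi> by auto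
    with F'(5)[of "?v X"] show "F (?v X) \<or> F (?v (elts \<kappa> - X))" by auto
  next
    fix \<gamma> and A :: "'a \<Rightarrow> 'a set"
    assume "\<gamma> \<in> elts \<kappa>" "\<forall>\<alpha>\<in>elts \<gamma>. A \<alpha> \<subseteq> elts \<kappa> \<and> F (?v (A \<alpha>))"
    then have "F {\<xi> \<in> elts \<kappa>. \<forall>\<alpha>\<in>elts \<gamma>. \<xi> \<in> ?v (A \<alpha>)}" by (intro F'(6)) auto
    also have "{\<xi> \<in> elts \<kappa>. \<forall>\<alpha>\<in>elts \<gamma>. \<xi> \<in> ?v (A \<alpha>)} =
      ?v {\<xi> \<in> elts \<kappa>. \<forall>\<alpha>\<in>elts \<gamma>. \<xi> \<in> A \<alpha>}"
      using \<phi> by auto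
    finally show "F (?v {\<xi> \<in> elts \<kappa>. \<forall>\<alpha>\<in>elts \<gamma>. \<xi> \<in> A \<alpha>})" .
  qed (use F'(2) in auto)
qed

lemma complete_uf_principal: "\<xi> \<in> elts \<kappa> \<Longrightarrow> complete_uf \<kappa> (\<lambda>X. \<xi> \<in> X)"
  by (auto simp: complete_uf_def)

lemma elts_fun_graph: "elts (fun_graph A F) = (\<lambda>x. vpair x (F x)) ` elts A"
  unfolding fun_graph_def by (intro elts_vset elts_replacement rangeI)

lemma vpair_fun_graph: "vpair x y \<in> elts (fun_graph A F) \<longleftrightarrow> x \<in> elts A \<and> y = F x"
  by (auto simp: elts_fun_graph vpair_eq_iff)

section \<open>Reflection at the critical point\<close>

context embedding
begin

lemma ordinal_\<kappa>: "ordinal \<kappa>"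
  and j_\<kappa>: "j \<kappa> \<noteq> \<kappa>"
  and j_below: "\<alpha> \<in> elts \<kappa> \<Longrightarrow> j \<alpha> = \<alpha>"
  using crit by (simp_all add: critical_point_def)

lemma mem_j_below: "z \<in> elts \<kappa> \<Longrightarrow> z \<in> elts (j x) \<longleftrightarrow> z \<in> elts x"
  by (metis j_mem j_below)

text \<open>Being an ordinal is a bounded property, and transitivity of \<open>M\<close> puts every
  set that its quantifiers range over into \<open>M\<close>.\<close>

lemma ordinal_j_\<kappa>: "ordinal (j \<kappa>)"
proof -
  have 1: "\<forall>x\<in>elts \<kappa>. \<forall>y\<in>elts x. y \<in> elts \<kappa>"
    and 2: "\<forall>x\<in>elts \<kappa>. \<forall>y\<in>elts x. \<forall>z\<in>elts y. z \<in> elts x"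
    using ordinal_\<kappa> unfolding ordinal_def transitive_class_def by blast+
  have "\<forall>x\<in>elts (j \<kappa>). \<forall>y\<in>M \<inter> elts x. y \<in> elts (j \<kappa>)"
    using transfer[of \<kappa> _ _ _ "BAll 4 0 (BAll 5 4 (Mem 5 0))"] 1 by simp
  moreover have "\<forall>x\<in>elts (j \<kappa>). \<forall>y\<in>M \<inter> elts x. \<forall>z\<in>M \<inter> elts y. z \<in> elts x"
    using transfer[of \<kappa> _ _ _ "BAll 4 0 (BAll 5 4 (BAll 6 5 (Mem 6 4)))"] 2 by simp
  ultimately have "y \<in> elts (j \<kappa>) \<and> (\<forall>z\<in>elts y. z \<in> elts x)"
    if "x \<in> elts (j \<kappa>)" "y \<in> elts x" for x y
  proof -
    have "y \<in> M" using that M_trans j_M by blast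
    with that show ?thesis
      using M_trans[OF \<open>y \<in> M\<close>] \<open>\<forall>x\<in>elts (j \<kappa>). \<forall>y\<in>M \<inter> elts x. y \<in> elts (j \<kappa>)\<close>
        \<open>\<forall>x\<in>elts (j \<kappa>). \<forall>y\<in>M \<inter> elts x. \<forall>z\<in>M \<inter> elts y. z \<in> elts x\<close> by blast
  qed
  then show ?thesis
    unfolding ordinal_def transitive_class_def by blast
qed

text \<open>Were \<open>j \<kappa>\<close> an element of \<open>\<kappa>\<close>, then
  \<open>j\<close> would fix it, and elementarity would make it an element of itself. Linearity
  leaves the claim, as \<open>j\<close> moves \<open>\<kappa>\<close>.\<close>

lemma \<kappa>_mem_j_\<kappa>: "\<kappa> \<in> elts (j \<kappa>)"
proof -
  have "j \<kappa> \<notin> elts \<kappa>"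
    using j_below[of "j \<kappa>"] mem_irrefl[of "j \<kappa>"] j_mem[of "j \<kappa>" \<kappa>] by auto
  then show ?thesis
    using ordinal_linear[OF ordinal_\<kappa> ordinal_j_\<kappa>] j_\<kappa> by auto
qed

lemma elts_below: "\<nu> \<in> elts \<kappa> \<Longrightarrow> elts \<nu> \<subseteq> elts \<kappa>"
  using ordinal_trans[OF ordinal_\<kappa>, of \<nu>] by blast

lemma j_bounded:
  assumes "\<nu> \<in> elts \<kappa>" "elts w \<subseteq> elts \<nu>"
  shows "j w = w"
proof (rule elts_ext)
  have "elts (j w) \<subseteq> elts \<nu>" using assms j_subset[of w \<nu>] j_below by simp
  then show "elts (j w) = elts w"
    using assms elts_below[of \<nu>] mem_j_below by blast
qed

text \<open>The trace \<open>b\<close> of \<open>p\<close> on \<open>\<nu>\<close> is fixed by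
  \<open>j\<close>, so the existence of an element with this trace reflects from \<open>j E\<close>
  to some \<open>q\<close> in \<open>E\<close>. Now \<open>p\<close> and \<open>j q\<close> have the
  same trace on \<open>\<nu>\<close>, and the elements of \<open>j E\<close> are separated by their
  traces as well.\<close>

lemma j_separated:
  assumes \<nu>: "\<nu> \<in> elts \<kappa>"
    and sep: "\<And>p q. p \<in> elts E \<Longrightarrow> q \<in> elts E \<Longrightarrow> elts p \<inter> elts \<nu> = elts q \<inter> elts \<nu> \<Longrightarrow> p = q"
    and p: "p \<in> elts (j E)"
  shows "\<exists>q\<in>elts E. p = j q"
proof -
  define b where "b = vset (elts p \<inter> elts \<nu>)"
  have b: "elts b = elts p \<inter> elts \<nu>"
    unfolding b_def by (rule small_subset[of _ \<nu>]) simp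
  have [simp]: "j b = b" "j \<nu> = \<nu>" using b \<nu> j_bounded j_below by auto
  \<comment> \<open>Kept in terms of \<open>j \<nu>\<close> and \<open>j b\<close>, although both
    are fixed, to match the formula that \<open>transfer\<close> yields.\<close>
  have "\<exists>q\<in>elts (j E). \<forall>z\<in>elts (j \<nu>). z \<in> elts q \<longleftrightarrow> z \<in> elts (j b)"
    using p by (intro bexI[of _ p]) (simp_all add: b)
  then obtain q where q: "q \<in> elts E" "\<forall>z\<in>elts \<nu>. z \<in> elts q \<longleftrightarrow> z \<in> elts b"
    using transfer[of E \<nu> b _ "BEx 4 0 (BAll 5 1 (Iff (Mem 5 4) (Mem 5 2)))"]
    by (auto simp del: \<open>j b = b\<close> \<open>j \<nu> = \<nu>\<close>)
  have "\<forall>p\<in>elts E. \<forall>q\<in>elts E. (\<forall>z\<in>elts \<nu>. z \<in> elts p \<longleftrightarrow> z \<in> elts q) \<longrightarrow> p = q"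
    using sep by blast
  then have "\<forall>p\<in>elts (j E). \<forall>q\<in>elts (j E). (\<forall>z\<in>elts (j \<nu>). z \<in> elts p \<longleftrightarrow> z \<in> elts q) \<longrightarrow> p = q"
    using transfer[of E \<nu> _ _
      "BAll 4 0 (BAll 5 0 (Imp (BAll 6 1 (Iff (Mem 6 4) (Mem 6 5))) (Eq 4 5)))"]
    by (simp del: \<open>j \<nu> = \<nu>\<close>)
  moreover have "\<forall>z\<in>elts (j \<nu>). z \<in> elts p \<longleftrightarrow> z \<in> elts (j q)"
    using q(2) b \<nu> elts_below[OF \<nu>] mem_j_below by auto
  ultimately have "p = j q" using p q(1) by simp
  with q show ?thesis by blast
qed

text \<open>Elementarity applied to the uniqueness of the value at \<open>i\<close>;
  \<open>a \<in> M\<close> brings \<open>a\<close> into the range of the quantifier over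
  \<open>M\<close>.\<close>

lemma j_fun_graph:
  assumes "a \<in> M" "vpair (j i) a \<in> elts (j (fun_graph A F))"
  shows "a = j (F i)"
  using transfer[of "fun_graph A F" i "F i" _ "Forall 4 (Imp (Rel 0 1 4) (Eq 4 2))"] assms
  by (simp add: trans_M trans_UNIV vpair_fun_graph)

text \<open>Both \<open>\<gamma>\<close> and its elements are fixed by \<open>j\<close>, so the
  image of the graph under \<open>j\<close> has the same domain and takes only the values
  \<open>j (f \<alpha>)\<close>. This is what makes the pullback below
  \<open>\<kappa>\<close>-complete.\<close>

lemma j_image_below:
  assumes \<gamma>: "\<gamma> \<in> elts \<kappa>"
  shows "elts (j (image_set f \<gamma>)) = (\<lambda>\<alpha>. j (f \<alpha>)) ` elts \<gamma>"
proof -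
  let ?T = "image_set f \<gamma>" and ?G = "fun_graph \<gamma> f"
  have "\<forall>y\<in>elts ?T. \<exists>\<alpha>\<in>elts \<gamma>. vpair \<alpha> y \<in> elts ?G"
    by (auto simp: elts_image_set vpair_fun_graph)
  then have "\<forall>y\<in>elts (j ?T). \<exists>\<alpha>\<in>elts (j \<gamma>). vpair \<alpha> y \<in> elts (j ?G)"
    using transfer[of ?T \<gamma> ?G _ "BAll 4 0 (BEx 5 1 (Rel 2 5 4))"]
    by (simp add: trans_M trans_UNIV)
  then have "y \<in> (\<lambda>\<alpha>. j (f \<alpha>)) ` elts \<gamma>" if y: "y \<in> elts (j ?T)" for y
  proof -
    from y obtain \<alpha> where \<alpha>: "\<alpha> \<in> elts \<gamma>" "vpair \<alpha> y \<in> elts (j ?G)"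
      using \<open>\<forall>y\<in>elts (j ?T). _ y\<close> j_below[OF \<gamma>] by auto
    moreover have "j \<alpha> = \<alpha>" using \<alpha>(1) elts_below[OF \<gamma>] j_below by blast
    ultimately have "y = j (f \<alpha>)"
      using j_fun_graph[of y \<alpha> \<gamma> f] M_trans[OF j_M y] by simp
    with \<alpha>(1) show ?thesis by blast
  qed
  then show ?thesis by (auto simp: elts_image_set)
qed

lemma j_finite: "finite X \<Longrightarrow> elts (j (vset X)) = j ` X"
proof (induction X rule: finite_induct)
  case empty
  show ?case
    using transfer[of "vset {}" _ _ _ "BAll 4 0 (Neg (Eq 4 4))"] by auto
next
  case (insert a X)
  have X: "elts (vset X) = X" "elts (vset (insert a X)) = insert a X"
    using insert by (auto intro!: elts_vset vset_finite)
  have "\<forall>x\<in>elts (vset (insert a X)). x \<in> elts (vset X) \<or> x = a"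
    by (auto simp: X)
  then have "\<forall>x\<in>elts (j (vset (insert a X))). x \<in> elts (j (vset X)) \<or> x = j a"
    using transfer[of "vset (insert a X)" "vset X" a _ "BAll 4 0 (Disj (Mem 4 1) (Eq 4 2))"]
    by simp
  then show ?case using insert.IH X by auto
qed

section \<open>The size of \<open>\<kappa>\<close> and the coding of pairs\<close>

lemma infinite_\<kappa>: "infinite (elts \<kappa>)"
proof
  assume "finite (elts \<kappa>)"
  then have "elts (j \<kappa>) = j ` elts \<kappa>" using j_finite[of "elts \<kappa>"] by simp
  then have "elts (j \<kappa>) = elts \<kappa>" using j_below by simp
  then show False using j_\<kappa> elts_ext by blast
qed

text \<open>The witness is the value \<open>t\<close> of \<open>j ?G\<close> at
  \<open>\<kappa>\<close>. If it were \<open>j (g \<alpha>)\<close>, it would also be the value at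
  \<open>j \<alpha>\<close>, and injectivity would give \<open>j \<alpha> = \<kappa>\<close>,
  although \<open>j\<close> fixes \<open>\<alpha>\<close>.\<close>

lemma j_image_\<kappa>:
  assumes inj: "inj_on g (elts \<kappa>)"
  shows "\<exists>t\<in>elts (j (image_set g \<kappa>)). t \<notin> range j"
proof -
  let ?I = "image_set g \<kappa>" and ?G = "fun_graph \<kappa> g"
  have "\<forall>\<alpha>\<in>elts \<kappa>. \<exists>t\<in>elts ?I. vpair \<alpha> t \<in> elts ?G"
    by (auto simp: elts_image_set vpair_fun_graph)
  then have "\<forall>\<alpha>\<in>elts (j \<kappa>). \<exists>t\<in>elts (j ?I). vpair \<alpha> t \<in> elts (j ?G)"
    using transfer[of \<kappa> ?I ?G _ "BAll 4 0 (BEx 5 1 (Rel 2 4 5))"]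
    by (simp add: trans_M trans_UNIV)
  then obtain t where t: "t \<in> elts (j ?I)" "vpair \<kappa> t \<in> elts (j ?G)"
    using \<kappa>_mem_j_\<kappa> by blast
  have "\<forall>\<alpha>\<in>elts \<kappa>. \<forall>\<beta>\<in>elts \<kappa>. \<forall>t\<in>elts ?I.
      vpair \<alpha> t \<in> elts ?G \<and> vpair \<beta> t \<in> elts ?G \<longrightarrow> \<alpha> = \<beta>"
    using inj by (auto simp: vpair_fun_graph inj_on_def)
  then have *: "\<forall>\<alpha>\<in>elts (j \<kappa>). \<forall>\<beta>\<in>elts (j \<kappa>). \<forall>t\<in>elts (j ?I).
      vpair \<alpha> t \<in> elts (j ?G) \<and> vpair \<beta> t \<in> elts (j ?G) \<longrightarrow> \<alpha> = \<beta>"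
    using transfer[of \<kappa> ?I ?G _
      "BAll 4 0 (BAll 5 0 (BAll 6 1 (Imp (Conj (Rel 2 4 6) (Rel 2 5 6)) (Eq 4 5))))"]
    by (simp add: trans_M trans_UNIV)
  have "t \<noteq> j e" for e
  proof
    assume e: "t = j e"
    with t obtain \<alpha> where \<alpha>: "\<alpha> \<in> elts \<kappa>" "e = g \<alpha>" by (auto simp: elts_image_set)
    then have "vpair (j \<alpha>) t \<in> elts (j ?G)" by (simp add: e vpair_fun_graph)
    moreover have "j \<alpha> \<in> elts (j \<kappa>)" using \<alpha> by simp
    ultimately have "j \<alpha> = \<kappa>" using * t \<kappa>_mem_j_\<kappa> by blast
    then show False using \<alpha>(1) j_below by auto
  qed
  with t show ?thesis by blast
qed

text \<open>Otherwise \<open>\<kappa>\<close> injects into the families of subsets of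
  \<open>\<beta>\<close>, and \<open>j_image_\<kappa>\<close> yields a \<open>t\<close> outside the
  range of \<open>j\<close>. By elementarity both \<open>t\<close> and \<open>j t\<close> are still
  families of subsets of \<open>\<beta>\<close>; since \<open>j\<close> fixes such subsets,
  \<open>j t = t\<close>, a contradiction.\<close>

lemma Pow_Pow_lepoll:
  assumes \<beta>: "\<beta> \<in> elts \<kappa>"
  shows "Pow (Pow (elts \<beta>)) \<lesssim> elts \<kappa>"
proof (rule ccontr)
  assume "\<not> Pow (Pow (elts \<beta>)) \<lesssim> elts \<kappa>"
  then have "elts \<kappa> \<lesssim> Pow (Pow (elts \<beta>))" using lepoll_total by blast
  then obtain g where g: "inj_on g (elts \<kappa>)" "g ` elts \<kappa> \<subseteq> Pow (Pow (elts \<beta>))"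
    unfolding lepoll_def by blast
  obtain p where p: "elts p = {y. elts y \<subseteq> elts \<beta>}" using elts_Pow[of \<beta>] by auto
  define h where "h \<alpha> = vset (vset ` g \<alpha>)" for \<alpha>
  have gs: "elts (vset w) = w" "w \<subseteq> elts \<beta>" if "\<alpha> \<in> elts \<kappa>" "w \<in> g \<alpha>" for \<alpha> w
    using g that by (auto intro!: small_subset[of _ \<beta>])
  have h: "elts (h \<alpha>) = vset ` g \<alpha>" if "\<alpha> \<in> elts \<kappa>" for \<alpha>
    unfolding h_def by (rule small_subset[of _ p]) (use gs[OF that] p in auto)
  have "elts ` elts (h \<alpha>) = g \<alpha>" if "\<alpha> \<in> elts \<kappa>" for \<alpha>
    using gs(1)[OF that] h[OF that] by (simp add: image_image)
  then have "inj_on h (elts \<kappa>)" using g(1) unfolding inj_on_def by metis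
  then obtain t where t: "t \<in> elts (j (image_set h \<kappa>))" "t \<notin> range j"
    using j_image_\<kappa> by blast
  have "\<forall>q\<in>elts (image_set h \<kappa>). \<forall>w\<in>elts q. \<forall>u\<in>elts w. u \<in> elts \<beta>"
    using gs h by (fastforce simp: elts_image_set)
  then have "\<forall>q\<in>elts (j (image_set h \<kappa>)). \<forall>w\<in>M \<inter> elts q. \<forall>u\<in>M \<inter> elts w. u \<in> elts \<beta>"
    using transfer[of "image_set h \<kappa>" \<beta> _ _ "BAll 4 0 (BAll 5 4 (BAll 6 5 (Mem 6 1)))"] j_below[OF \<beta>]
    by simp
  then have tw: "elts w \<subseteq> elts \<beta>" if "w \<in> elts t" for w
    using t(1) that M_trans[OF M_trans[OF M_trans[OF j_M t(1)] that]] M_trans[OF M_trans[OF j_M t(1)] that]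
    by blast
  then have "\<forall>w\<in>elts t. \<forall>u\<in>elts w. u \<in> elts \<beta>" by blast
  then have "\<forall>w\<in>elts (j t). \<forall>u\<in>M \<inter> elts w. u \<in> elts \<beta>"
    using transfer[of t \<beta> _ _ "BAll 4 0 (BAll 5 4 (Mem 5 1))"] j_below[OF \<beta>] by simp
  then have jtw: "elts w \<subseteq> elts \<beta>" if "w \<in> elts (j t)" for w
    using that M_trans[OF M_trans[OF j_M that]] by blast
  have "elts (j t) = elts t"
  proof (intro set_eqI iffI)
    fix w assume "w \<in> elts (j t)"
    with j_bounded[OF \<beta> jtw] show "w \<in> elts t" by (metis j_mem)
  next
    fix w assume "w \<in> elts t"
    with j_bounded[OF \<beta> tw] show "w \<in> elts (j t)" by (metis j_mem)
  qed
  then have "j t = t" by (rule elts_ext)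
  with t(2) show False by (metis rangeI)
qed

text \<open>A sum of \<open>\<kappa>\<close> many sets of size at most \<open>\<kappa>\<close> has
  size at most \<open>\<kappa>\<close>, because \<open>\<kappa>\<close> is infinite.\<close>

lemma ex_coding:
  "\<exists>c. inj_on c (SIGMA \<beta>:elts \<kappa>. Pow (Pow (elts \<beta>))) \<and>
    c ` (SIGMA \<beta>:elts \<kappa>. Pow (Pow (elts \<beta>))) \<subseteq> elts \<kappa>"
  unfolding card_of_ordLeq
proof (rule card_of_Sigma_ordLeq_infinite[OF infinite_\<kappa>])
  show "\<forall>\<beta>\<in>elts \<kappa>. (card_of (Pow (Pow (elts \<beta>))), card_of (elts \<kappa>)) \<in> ordLeq"
    using Pow_Pow_lepoll unfolding lepoll_def card_of_ordLeq by blast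
qed (rule ordLeq_refl[OF card_of_Card_order])

end

text \<open>Gathered into one set, the ultrafilters can serve as a parameter:
  \<open>j (ultrafilters \<kappa>)\<close> stands for the notion in \<open>M\<close>, and no formula
  has to spell it out.\<close>

definition ultrafilters :: "'v::zfc_universe \<Rightarrow> 'v" where
  "ultrafilters \<kappa> = vset {W. complete_ultrafilter_over \<kappa> W}"

lemma elts_ultrafilters: "elts (ultrafilters \<kappa>) = {W. complete_ultrafilter_over \<kappa> W}"
proof -
  obtain p where p: "elts p = {X. elts X \<subseteq> elts \<kappa>}" using elts_Pow[of \<kappa>] by auto
  obtain q where q: "elts q = {W. elts W \<subseteq> elts p}" using elts_Pow[of p] by auto
  have "{W. complete_ultrafilter_over \<kappa> W} \<subseteq> elts q"
    unfolding p q complete_ultrafilter_over_def ultrafilter_over_def by blast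
  then show ?thesis unfolding ultrafilters_def by (rule small_subset)
qed

section \<open>Ultrafilters of \<open>M\<close> over \<open>j \<kappa>\<close> and their
  pullbacks\<close>

context embedding
begin

text \<open>Transfers one closure rule with premises \<open>T\<close> and conclusion
  \<open>Y\<close>. Closure under supersets, binary intersections and intersections of length below
  \<open>\<kappa>\<close> are all of this shape.\<close>

lemma mem_j_ultrafilter:
  assumes "\<And>W. complete_ultrafilter_over \<kappa> W \<Longrightarrow> elts T \<subseteq> elts W \<Longrightarrow> Y \<in> elts W"
    and "W' \<in> elts (j (ultrafilters \<kappa>))" "elts (j T) \<subseteq> elts W'"
  shows "j Y \<in> elts W'"
proof -
  have "\<forall>W\<in>elts (ultrafilters \<kappa>). (\<forall>t\<in>elts T. t \<in> elts W) \<longrightarrow> Y \<in> elts W"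
    using assms(1) by (auto simp: elts_ultrafilters)
  then have "\<forall>W\<in>elts (j (ultrafilters \<kappa>)). (\<forall>t\<in>elts (j T). t \<in> elts W) \<longrightarrow> j Y \<in> elts W"
    using transfer[of "ultrafilters \<kappa>" T Y _ "BAll 4 0 (Imp (BAll 5 1 (Mem 5 4)) (Mem 2 4))"]
    by simp
  with assms(2,3) show ?thesis by blast
qed

lemma mem_j_ultrafilter_finite:
  assumes "\<And>W. complete_uf \<kappa> (\<lambda>X. X \<subseteq> elts \<kappa> \<and> vset X \<in> elts W) \<Longrightarrow> T \<subseteq> elts W \<Longrightarrow> Y \<in> elts W"
    and "finite T" and "W' \<in> elts (j (ultrafilters \<kappa>))" "j ` T \<subseteq> elts W'"
  shows "j Y \<in> elts W'"
  using mem_j_ultrafilter[of "vset T" Y W'] assms j_finite[of T]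
  by (simp add: elts_vset vset_finite complete_uf_of_ultrafilter)

definition pullback :: "'v \<Rightarrow> 'v" where
  "pullback W' = vset {X. elts X \<subseteq> elts \<kappa> \<and> j X \<in> elts W'}"

lemma elts_pullback: "elts (pullback W') = {X. elts X \<subseteq> elts \<kappa> \<and> j X \<in> elts W'}"
  unfolding pullback_def by (rule elts_family)

text \<open>The closure axioms come from \<open>mem_j_ultrafilter\<close>, with an empty set of
  premises for the membership of \<open>\<kappa>\<close>; properness and maximality are transferred
  directly. For completeness, \<open>j\<close> adds no new members to a family indexed by
  \<open>\<gamma>\<close>.\<close>

lemma complete_ultrafilter_pullback:
  assumes W': "W' \<in> elts (j (ultrafilters \<kappa>))"
  shows "complete_ultrafilter_over \<kappa> (pullback W')"
proof -
  have "complete_uf \<kappa> (\<lambda>X. j (vset X) \<in> elts W')"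
    unfolding complete_uf_def
  proof (intro conjI allI ballI impI; (elim conjE)?)
    show "j (vset (elts \<kappa>)) \<in> elts W'"
      by (rule mem_j_ultrafilter_finite[OF _ _ W', of "{}"]) (use complete_ufD(1) in fastforce)+
  next
    have "\<forall>W\<in>elts (ultrafilters \<kappa>). vset {} \<notin> elts W"
      using complete_ufD(2)[OF complete_uf_of_ultrafilter] by (auto simp: elts_ultrafilters)
    then show "j (vset {}) \<notin> elts W'"
      using transfer[of "ultrafilters \<kappa>" "vset {}" _ _ "BAll 4 0 (Neg (Mem 1 4))"] W' by simp
  next
    fix X Y assume *: "j (vset X) \<in> elts W'" "X \<subseteq> Y" "Y \<subseteq> elts \<kappa>"
    show "j (vset Y) \<in> elts W'"
    proof (rule mem_j_ultrafilter_finite[OF _ _ W', of "{vset X}"])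
      fix W assume "complete_uf \<kappa> (\<lambda>X. X \<subseteq> elts \<kappa> \<and> vset X \<in> elts W)" "{vset X} \<subseteq> elts W"
      then show "vset Y \<in> elts W" using complete_ufD(3)[of \<kappa> _ X Y] * by blast
    qed (use * in auto)
  next
    fix X Y assume *: "j (vset X) \<in> elts W'" "j (vset Y) \<in> elts W'" "X \<subseteq> elts \<kappa>" "Y \<subseteq> elts \<kappa>"
    show "j (vset (X \<inter> Y)) \<in> elts W'"
    proof (rule mem_j_ultrafilter_finite[OF _ _ W', of "{vset X, vset Y}"])
      fix W assume "complete_uf \<kappa> (\<lambda>X. X \<subseteq> elts \<kappa> \<and> vset X \<in> elts W)"
        "{vset X, vset Y} \<subseteq> elts W"
      then show "vset (X \<inter> Y) \<in> elts W" using complete_ufD(4)[of \<kappa> _ X Y] * by blast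
    qed (use * in auto)
  next
    fix X assume X: "X \<subseteq> elts \<kappa>"
    have "\<forall>W\<in>elts (ultrafilters \<kappa>). vset X \<in> elts W \<or> vset (elts \<kappa> - X) \<in> elts W"
      using complete_ufD(5)[OF complete_uf_of_ultrafilter X] by (auto simp: elts_ultrafilters)
    then show "j (vset X) \<in> elts W' \<or> j (vset (elts \<kappa> - X)) \<in> elts W'"
      using transfer[of "ultrafilters \<kappa>" "vset X" "vset (elts \<kappa> - X)" _
        "BAll 4 0 (Disj (Mem 1 4) (Mem 2 4))"] W' by simp
  next
    fix \<gamma> and A :: "'v \<Rightarrow> 'v set"
    assume \<gamma>: "\<gamma> \<in> elts \<kappa>" and A: "\<forall>\<alpha>\<in>elts \<gamma>. A \<alpha> \<subseteq> elts \<kappa> \<and> j (vset (A \<alpha>)) \<in> elts W'"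
    let ?T = "image_set (\<lambda>\<alpha>. vset (A \<alpha>)) \<gamma>"
    show "j (vset {\<xi> \<in> elts \<kappa>. \<forall>\<alpha>\<in>elts \<gamma>. \<xi> \<in> A \<alpha>}) \<in> elts W'"
    proof (rule mem_j_ultrafilter[OF _ W', of ?T])
      fix W assume "complete_ultrafilter_over \<kappa> W" "elts ?T \<subseteq> elts W"
      then show "vset {\<xi> \<in> elts \<kappa>. \<forall>\<alpha>\<in>elts \<gamma>. \<xi> \<in> A \<alpha>} \<in> elts W"
        using complete_ufD(6)[OF complete_uf_of_ultrafilter \<gamma>, of W A] A
        by (auto simp: elts_image_set)
    next
      show "elts (j ?T) \<subseteq> elts W'" using j_image_below[OF \<gamma>] A by auto
    qed
  qed
  from ultrafilter_of_complete_uf[OF this] show ?thesis by (simp add: pullback_def)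
qed

text \<open>The derived ultrafilter is the pullback of the principal ultrafilter of \<open>M\<close> at \<open>\<kappa>\<close>.\<close>

lemma ex_derived_ultrafilter:
  "\<exists>U. complete_ultrafilter_over \<kappa> U \<and> elts U = {X. elts X \<subseteq> elts \<kappa> \<and> \<kappa> \<in> elts (j X)}"
proof -
  obtain p where p: "elts p = {X. elts X \<subseteq> elts \<kappa>}" using elts_Pow[of \<kappa>] by auto
  have "\<forall>\<xi>\<in>elts \<kappa>. \<exists>W\<in>elts (ultrafilters \<kappa>). \<forall>X\<in>elts p. X \<in> elts W \<longleftrightarrow> \<xi> \<in> elts X"
  proof
    fix \<xi> assume "\<xi> \<in> elts \<kappa>"
    from ultrafilter_of_complete_uf[OF complete_uf_principal[OF this]]
    show "\<exists>W\<in>elts (ultrafilters \<kappa>). \<forall>X\<in>elts p. X \<in> elts W \<longleftrightarrow> \<xi> \<in> elts X"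
      unfolding elts_ultrafilters p
      by (intro bexI[of _ "vset {X. elts X \<subseteq> elts \<kappa> \<and> \<xi> \<in> elts X}"]) (simp_all add: elts_family)
  qed
  then have "\<forall>\<xi>\<in>elts (j \<kappa>). \<exists>W\<in>elts (j (ultrafilters \<kappa>)). \<forall>X\<in>elts (j p). X \<in> elts W \<longleftrightarrow> \<xi> \<in> elts X"
    using transfer[of \<kappa> "ultrafilters \<kappa>" p _ "BAll 4 0 (BEx 5 1 (BAll 6 2 (Iff (Mem 6 5) (Mem 4 6))))"]
    by simp
  then obtain W' where W': "W' \<in> elts (j (ultrafilters \<kappa>))"
    "\<And>X. X \<in> elts (j p) \<Longrightarrow> X \<in> elts W' \<longleftrightarrow> \<kappa> \<in> elts X"
    using \<kappa>_mem_j_\<kappa> by blast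
  have "j X \<in> elts W' \<longleftrightarrow> \<kappa> \<in> elts (j X)" if "elts X \<subseteq> elts \<kappa>" for X
    using W'(2)[of "j X"] that by (simp add: p)
  then show ?thesis
    using complete_ultrafilter_pullback[OF W'(1)]
    by (intro exI[of _ "pullback W'"]) (auto simp: elts_pullback)
qed

text \<open>If \<open>i\<close> is in \<open>D\<close>, the preimage of \<open>A i\<close> under
  \<open>\<phi>\<close> is all of \<open>\<kappa>\<close>. Conversely, if the preimage is in
  \<open>U\<close>, then \<open>j (vset (x i))\<close> agrees below \<open>\<kappa>\<close> with an
  element of \<open>j ?E\<close>, where \<open>?E\<close> collects the sets indexed by
  \<open>D\<close>. By separation that element is some \<open>j (vset (x i'))\<close> with
  \<open>i'\<close> in \<open>D\<close>, and traces on \<open>\<kappa>\<close> give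
  \<open>x i = x i'\<close>.\<close>

lemma ex_prescribed_ultrafilter:
  fixes x :: "'v \<Rightarrow> 'v set"
  defines "C \<equiv> SIGMA \<beta>:elts \<kappa>. Pow (Pow (elts \<beta>))"
  assumes x: "inj_on x (elts \<theta>)" "x ` elts \<theta> \<subseteq> Pow (elts \<kappa>)"
    and c: "inj_on c C" "c ` C \<subseteq> elts \<kappa>"
    and A: "\<And>i. i \<in> elts \<theta> \<Longrightarrow> elts (A i) = {c (\<beta>, S) |\<beta> S. (\<beta>, S) \<in> C \<and> x i \<inter> elts \<beta> \<in> S}"
    and \<nu>: "\<nu> \<in> elts \<kappa>" and D: "elts D \<subseteq> elts \<theta>"
    and sep: "\<And>i i'. i \<in> elts D \<Longrightarrow> i' \<in> elts D \<Longrightarrow> x i \<inter> elts \<nu> = x i' \<inter> elts \<nu> \<Longrightarrow> i = i'"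
  shows "\<exists>W. complete_ultrafilter_over \<kappa> W \<and> (\<forall>i\<in>elts \<theta>. A i \<in> elts W \<longleftrightarrow> i \<in> elts D)"
proof -
  obtain U where U: "complete_ultrafilter_over \<kappa> U"
    "elts U = {X. elts X \<subseteq> elts \<kappa> \<and> \<kappa> \<in> elts (j X)}"
    using ex_derived_ultrafilter by blast
  define S where "S \<xi> = (\<lambda>i. x i \<inter> elts \<xi>) ` elts D" for \<xi>
  define \<phi> where "\<phi> \<xi> = c (\<xi>, S \<xi>)" for \<xi>
  let ?F = "\<lambda>X. X \<subseteq> elts \<kappa> \<and> vset X \<in> elts U"
  let ?G = "\<lambda>X. ?F {\<xi> \<in> elts \<kappa>. \<phi> \<xi> \<in> X}"
  let ?W = "vset {X. elts X \<subseteq> elts \<kappa> \<and> ?G (elts X)}"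
  note F = complete_uf_of_ultrafilter[OF U(1)]
  have C: "(\<xi>, S \<xi>) \<in> C" if "\<xi> \<in> elts \<kappa>" for \<xi>
    using that by (auto simp: C_def S_def)
  have "\<phi> \<xi> \<in> elts \<kappa>" if "\<xi> \<in> elts \<kappa>" for \<xi>
    using C[OF that] c(2) unfolding \<phi>_def by blast
  from ultrafilter_of_complete_uf[OF complete_uf_vimage[OF F this]]
  have W: "complete_ultrafilter_over \<kappa> ?W" by simp
  \<comment> \<open>Injectivity of \<open>c\<close> recovers \<open>\<xi>\<close> and
    \<open>S \<xi>\<close> from the code \<open>\<phi> \<xi>\<close>.\<close>
  have \<phi>A: "\<phi> \<xi> \<in> elts (A i) \<longleftrightarrow> x i \<inter> elts \<xi> \<in> S \<xi>" if "\<xi> \<in> elts \<kappa>" "i \<in> elts \<theta>" for \<xi> i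
  proof -
    have "\<phi> \<xi> = c (\<beta>, T) \<longleftrightarrow> \<xi> = \<beta> \<and> S \<xi> = T" if "(\<beta>, T) \<in> C" for \<beta> T
      using inj_on_eq_iff[OF c(1) C[OF \<open>\<xi> \<in> elts \<kappa>\<close>] that] by (simp add: \<phi>_def)
    then show ?thesis
      unfolding A[OF that(2)] using C[OF that(1)] by blast
  qed
  have "A i \<in> elts ?W \<longleftrightarrow> i \<in> elts D" if i: "i \<in> elts \<theta>" for i
  proof -
    let ?X = "{\<xi> \<in> elts \<kappa>. x i \<inter> elts \<xi> \<in> S \<xi>}"
    have X: "{\<xi> \<in> elts \<kappa>. \<phi> \<xi> \<in> elts (A i)} = ?X" using \<phi>A i by blast
    have "elts (A i) \<subseteq> elts \<kappa>" unfolding A[OF i] using c(2) by blast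
    then have AW: "A i \<in> elts ?W \<longleftrightarrow> vset ?X \<in> elts U"
      unfolding elts_family X[symmetric] by blast
    show ?thesis
    proof
      assume "i \<in> elts D"
      then have "?X = elts \<kappa>" by (auto simp: S_def)
      with AW complete_ufD(1)[OF F] show "A i \<in> elts ?W" by simp
    next
      assume "A i \<in> elts ?W"
      then have \<kappa>: "\<kappa> \<in> elts (j (vset ?X))" using AW U(2) by simp
      let ?E = "image_set (\<lambda>i. vset (x i)) D"
      have vx: "elts (vset (x i)) = x i" if "i \<in> elts \<theta>" for i
        by (rule small_subset[of _ \<kappa>]) (use x(2) that in blast)
      have eX: "elts (vset ?X) = ?X" by (rule small_subset[of _ \<kappa>]) blast
      have "\<forall>\<xi>\<in>elts (vset ?X). \<exists>e\<in>elts ?E. \<forall>z\<in>elts \<xi>. z \<in> elts e \<longleftrightarrow> z \<in> elts (vset (x i))"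
      proof
        fix \<xi> assume "\<xi> \<in> elts (vset ?X)"
        then have "x i \<inter> elts \<xi> \<in> S \<xi>" using eX by blast
        then obtain i' where "i' \<in> elts D" "x i \<inter> elts \<xi> = x i' \<inter> elts \<xi>"
          unfolding S_def by blast
        then show "\<exists>e\<in>elts ?E. \<forall>z\<in>elts \<xi>. z \<in> elts e \<longleftrightarrow> z \<in> elts (vset (x i))"
          using vx i D unfolding elts_image_set by (intro bexI[of _ "vset (x i')"]) auto
      qed
      then have "\<forall>\<xi>\<in>elts (j (vset ?X)). \<exists>e\<in>elts (j ?E).
          \<forall>z\<in>M \<inter> elts \<xi>. z \<in> elts e \<longleftrightarrow> z \<in> elts (j (vset (x i)))"
        using transfer[of "vset ?X" ?E "vset (x i)" _
          "BAll 4 0 (BEx 5 1 (BAll 6 4 (Iff (Mem 6 5) (Mem 6 2))))"] by simp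
      \<comment> \<open>The instance of the transferred statement at \<open>\<kappa>\<close>, which
        is an element of \<open>j (vset ?X)\<close> by the definition of \<open>U\<close>.\<close>
      then obtain e where e: "e \<in> elts (j ?E)"
        "\<forall>z\<in>M \<inter> elts \<kappa>. z \<in> elts e \<longleftrightarrow> z \<in> elts (j (vset (x i)))"
        using \<kappa> by blast
      have "\<exists>q\<in>elts ?E. e = j q"
      proof (rule j_separated[OF \<nu> _ e(1)])
        fix p q assume "p \<in> elts ?E" "q \<in> elts ?E"
          and pq: "elts p \<inter> elts \<nu> = elts q \<inter> elts \<nu>"
        then obtain i1 i2 where "i1 \<in> elts D" "i2 \<in> elts D" "p = vset (x i1)" "q = vset (x i2)"
          by (auto simp: elts_image_set)
        with pq sep[of i1 i2] vx D show "p = q" by auto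
      qed
      then obtain i' where i': "i' \<in> elts D" "e = j (vset (x i'))"
        by (auto simp: elts_image_set)
      have M: "z \<in> M" if "z \<in> elts \<kappa>" for z using j_below[OF that] j_M[of z] by simp
      have i'\<theta>: "i' \<in> elts \<theta>" using i' D by blast
      have "z \<in> x i' \<longleftrightarrow> z \<in> x i" if "z \<in> elts \<kappa>" for z
      proof -
        have "z \<in> elts e \<longleftrightarrow> z \<in> elts (j (vset (x i)))" using e(2) M that by blast
        then show ?thesis using i'(2) mem_j_below[OF that] vx[OF i] vx[OF i'\<theta>] by simp
      qed
      then have "x i' = x i" using x(2) i'\<theta> i by blast
      then have "i' = i" using x(1) i'\<theta> i by (simp add: inj_on_eq_iff)
      with i' show "i \<in> elts D" by simp
    qed
  qed
  with W show ?thesis by blast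
qed

section \<open>Construction of the non-Galvin ultrafilter\<close>

theorem ex_non_Galvin:
  assumes jM: "image_set j (succ_cardinal \<kappa>) \<in> M"
  shows "\<exists>W. complete_ultrafilter_over \<kappa> W \<and>
    (\<exists>A. (\<forall>i\<in>elts (succ_cardinal \<kappa>). A i \<in> elts W) \<and>
      (\<forall>I. elts I \<subseteq> elts (succ_cardinal \<kappa>) \<and> elts I \<approx> elts \<kappa> \<longrightarrow>
        vInter \<kappa> I A \<notin> elts W))"
proof -
  let ?\<theta> = "succ_cardinal \<kappa>"
  let ?\<U> = "ultrafilters \<kappa>"
  obtain x where x: "inj_on x (elts ?\<theta>)" "x ` elts ?\<theta> \<subseteq> Pow (elts \<kappa>)"
    using succ_cardinal_lepoll_Pow[OF ordinal_\<kappa>] unfolding lepoll_def by blast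
  let ?C = "SIGMA \<beta>:elts \<kappa>. Pow (Pow (elts \<beta>))"
  obtain c where c: "inj_on c ?C" "c ` ?C \<subseteq> elts \<kappa>" using ex_coding by blast
  define A where "A i = vset {c (\<beta>, S) |\<beta> S. (\<beta>, S) \<in> ?C \<and> x i \<inter> elts \<beta> \<in> S}" for i
  have A: "elts (A i) = {c (\<beta>, S) |\<beta> S. (\<beta>, S) \<in> ?C \<and> x i \<inter> elts \<beta> \<in> S}" for i
    unfolding A_def by (rule small_subset[of _ \<kappa>]) (use c(2) in blast)
  have A\<kappa>: "elts (A i) \<subseteq> elts \<kappa>" for i
    unfolding A using c(2) by blast
  define X where "X i = vset (x i)" for i
  have X: "elts (X i) = x i" if "i \<in> elts ?\<theta>" for i
    unfolding X_def by (rule small_subset[of _ \<kappa>]) (use x(2) that in blast)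
  \<comment> \<open>Here \<open>sep d \<nu>\<close> says that \<open>\<nu>\<close> witnesses the
    smallness of \<open>d\<close>, and \<open>\<S>\<close> will be the set of small subsets of
    \<open>\<kappa>\<^sup>+\<close>.\<close>
  define sep where "sep d \<nu> \<longleftrightarrow> (\<forall>i\<in>elts d. \<forall>i'\<in>elts d.
    (\<forall>z\<in>elts \<nu>. z \<in> elts (X i) \<longleftrightarrow> z \<in> elts (X i')) \<longrightarrow> i = i')" for d \<nu>
  define \<S> where "\<S> = vset {d. elts d \<subseteq> elts ?\<theta> \<and> (\<exists>\<nu>\<in>elts \<kappa>. sep d \<nu>)}"
  have \<S>: "elts \<S> = {d. elts d \<subseteq> elts ?\<theta> \<and> (\<exists>\<nu>\<in>elts \<kappa>. sep d \<nu>)}"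
    unfolding \<S>_def by (rule elts_family)
  let ?XG = "fun_graph ?\<theta> X" and ?AG = "fun_graph ?\<theta> A"
  let ?D = "image_set j ?\<theta>"

  \<comment> \<open>Only the direction from smallness to membership in \<open>\<S>\<close> is needed
    to put \<open>?D\<close> into \<open>j \<S>\<close>. The values of \<open>X\<close> enter
    through pairs in \<open>?XG\<close>, so that the formula avoids function application.\<close>
  have "\<forall>d. elts d \<subseteq> elts ?\<theta> \<and> (\<exists>\<nu>\<in>elts \<kappa>. \<forall>i\<in>elts d. \<forall>i'\<in>elts d. \<forall>a a'.
      vpair i a \<in> elts ?XG \<and> vpair i' a' \<in> elts ?XG \<and>
      (\<forall>z\<in>elts \<nu>. z \<in> elts a \<longleftrightarrow> z \<in> elts a') \<longrightarrow> i = i') \<longrightarrow> d \<in> elts \<S>"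
    unfolding \<S> sep_def by (auto simp: vpair_fun_graph subset_iff) blast
  then have "\<forall>d\<in>M. elts d \<subseteq> elts (j ?\<theta>) \<and> (\<exists>\<nu>\<in>elts (j \<kappa>). \<forall>i\<in>M \<inter> elts d. \<forall>i'\<in>M \<inter> elts d.
      \<forall>a\<in>M. \<forall>a'\<in>M. vpair i a \<in> elts (j ?XG) \<and> vpair i' a' \<in> elts (j ?XG) \<and>
      (\<forall>z\<in>M \<inter> elts \<nu>. z \<in> elts a \<longleftrightarrow> z \<in> elts a') \<longrightarrow> i = i') \<longrightarrow> d \<in> elts (j \<S>)"
    using transfer[of ?\<theta> \<kappa> ?XG \<S>
      "Forall 4 (Imp (Conj (BAll 5 4 (Mem 5 0)) (BEx 5 1 (BAll 6 4 (BAll 7 4 (Forall 8 (Forall 9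
        (Imp (Conj (Rel 2 6 8) (Conj (Rel 2 7 9) (BAll 10 5 (Iff (Mem 10 8) (Mem 10 9)))))
          (Eq 6 7)))))))) (Mem 4 3))"]
    by (simp add: trans_M trans_UNIV subset_eq)
  \<comment> \<open>Smallness of \<open>?D\<close> in \<open>M\<close> with
    \<open>\<nu> = \<kappa>\<close>: the image under \<open>j\<close> of a subset of
    \<open>\<kappa>\<close> has that subset as its trace on \<open>\<kappa>\<close>, so injectivity
    of \<open>x\<close> suffices.\<close>
  moreover have "i = i'" if "i \<in> elts ?D" "i' \<in> elts ?D" "a \<in> M" "a' \<in> M"
    "vpair i a \<in> elts (j ?XG)" "vpair i' a' \<in> elts (j ?XG)"
    and eq: "\<forall>z\<in>M \<inter> elts \<kappa>. z \<in> elts a \<longleftrightarrow> z \<in> elts a'" for i i' a a'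
  proof -
    from that obtain i0 i1 where i: "i0 \<in> elts ?\<theta>" "i1 \<in> elts ?\<theta>" "i = j i0" "i' = j i1"
      by (auto simp: elts_image_set)
    with that have a: "a = j (X i0)" "a' = j (X i1)" by (auto dest: j_fun_graph)
    have "z \<in> x i0 \<longleftrightarrow> z \<in> x i1" if "z \<in> elts \<kappa>" for z
      using eq j_below[OF that] j_M[of z] that mem_j_below[OF that] X i a by auto
    then have "x i0 = x i1" using x(2) i by blast
    with x(1) i show ?thesis by (simp add: inj_on_eq_iff)
  qed
  moreover have "elts ?D \<subseteq> elts (j ?\<theta>)" by (auto simp: elts_image_set)
  \<comment> \<open>The assumption \<open>jM\<close> enters because the transferred statement
    quantifies only over \<open>d\<close> in \<open>M\<close>.\<close>
  ultimately have D: "?D \<in> elts (j \<S>)"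
    using jM \<kappa>_mem_j_\<kappa> by blast

  \<comment> \<open>The prescribed ultrafilters are stated for all small \<open>d\<close> at once,
    so that elementarity can be applied to the set \<open>?D\<close> of \<open>M\<close>, which need
    not be of the form \<open>j d\<close>.\<close>
  have "\<forall>d\<in>elts \<S>. \<exists>W\<in>elts ?\<U>. \<forall>i\<in>elts ?\<theta>. \<forall>a. vpair i a \<in> elts ?AG \<longrightarrow>
      (a \<in> elts W \<longleftrightarrow> i \<in> elts d)"
  proof
    fix d assume "d \<in> elts \<S>"
    then obtain \<nu> where d: "elts d \<subseteq> elts ?\<theta>" and \<nu>: "\<nu> \<in> elts \<kappa>" "sep d \<nu>" by (auto simp: \<S>)
    have "i = i'" if "i \<in> elts d" "i' \<in> elts d" "x i \<inter> elts \<nu> = x i' \<inter> elts \<nu>" for i i'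
    proof -
      have "\<forall>z\<in>elts \<nu>. z \<in> elts (X i) \<longleftrightarrow> z \<in> elts (X i')" using that X d by blast
      with that \<nu>(2) show ?thesis unfolding sep_def by blast
    qed
    then obtain W where "complete_ultrafilter_over \<kappa> W" "\<forall>i\<in>elts ?\<theta>. A i \<in> elts W \<longleftrightarrow> i \<in> elts d"
      using ex_prescribed_ultrafilter[OF x c A \<nu>(1) d] by blast
    then show "\<exists>W\<in>elts ?\<U>. \<forall>i\<in>elts ?\<theta>. \<forall>a. vpair i a \<in> elts ?AG \<longrightarrow> (a \<in> elts W \<longleftrightarrow> i \<in> elts d)"
      by (intro bexI[of _ W]) (simp_all add: elts_ultrafilters vpair_fun_graph)
  qed
  then have "\<forall>d\<in>elts (j \<S>). \<exists>W\<in>elts (j ?\<U>). \<forall>i\<in>elts (j ?\<theta>). \<forall>a\<in>M. vpair i a \<in> elts (j ?AG) \<longrightarrow>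
      (a \<in> elts W \<longleftrightarrow> i \<in> elts d)"
    using transfer[of \<S> ?\<U> ?\<theta> ?AG
      "BAll 4 0 (BEx 5 1 (BAll 6 2 (Forall 7 (Imp (Rel 3 6 7) (Iff (Mem 7 5) (Mem 6 4))))))"]
    by (simp add: trans_M trans_UNIV)
  then obtain W' where W': "W' \<in> elts (j ?\<U>)"
    and prescribed: "\<And>i a. i \<in> elts (j ?\<theta>) \<Longrightarrow> a \<in> M \<Longrightarrow> vpair i a \<in> elts (j ?AG) \<Longrightarrow>
      a \<in> elts W' \<longleftrightarrow> i \<in> elts ?D"
    using D by blast

  have "A i \<in> elts (pullback W')" if "i \<in> elts ?\<theta>" for i
    using prescribed[of "j i" "j (A i)"] that A\<kappa>
    by (simp add: elts_pullback vpair_fun_graph elts_image_set)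
  moreover have "vInter \<kappa> I A \<notin> elts (pullback W')"
    if I: "elts I \<subseteq> elts ?\<theta>" "elts I \<approx> elts \<kappa>" for I
  proof
    let ?Y = "vInter \<kappa> I A"
    assume Y: "?Y \<in> elts (pullback W')"
    have eY: "elts ?Y = {\<xi> \<in> elts \<kappa>. \<forall>i\<in>elts I. \<xi> \<in> elts (A i)}"
      unfolding vInter_def by (rule small_subset[of _ \<kappa>]) blast
    \<comment> \<open>Upward closure, phrased for transfer: once \<open>W'\<close> contains
      \<open>j ?Y\<close>, it contains the set that \<open>j ?AG\<close> assigns to any index in
      \<open>j I\<close>, even to one outside the range of \<open>j\<close>.\<close>
    have "\<forall>i\<in>elts I. \<exists>a. vpair i a \<in> elts ?AG \<and> (\<forall>W\<in>elts ?\<U>. ?Y \<in> elts W \<longrightarrow> a \<in> elts W)"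
    proof
      fix i assume i: "i \<in> elts I"
      have YA: "elts ?Y \<subseteq> elts (A i)" unfolding eY using i by blast
      have "A i \<in> elts W" if "complete_ultrafilter_over \<kappa> W" "?Y \<in> elts W" for W
        using complete_ufD(3)[OF complete_uf_of_ultrafilter[OF that(1)], of "elts ?Y" "elts (A i)"]
          that(2) A\<kappa>[of i] YA by simp
      with i I show "\<exists>a. vpair i a \<in> elts ?AG \<and> (\<forall>W\<in>elts ?\<U>. ?Y \<in> elts W \<longrightarrow> a \<in> elts W)"
        by (intro exI[of _ "A i"]) (auto simp: vpair_fun_graph elts_ultrafilters)
    qed
    then have *: "\<forall>i\<in>elts (j I). \<exists>a\<in>M. vpair i a \<in> elts (j ?AG) \<and>
        (\<forall>W\<in>elts (j ?\<U>). j ?Y \<in> elts W \<longrightarrow> a \<in> elts W)"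
      using transfer[of I ?AG ?Y ?\<U>
        "BAll 4 0 (Ex 5 (Conj (Rel 1 4 5) (BAll 6 3 (Imp (Mem 2 6) (Mem 5 6)))))"]
      by (simp add: trans_M trans_UNIV)
    obtain g where g: "bij_betw g (elts \<kappa>) (elts I)"
      using eqpoll_sym[OF I(2)] unfolding eqpoll_def by blast
    then have "I = image_set g \<kappa>"
      by (intro elts_ext) (simp add: elts_image_set bij_betw_def)
    \<comment> \<open>Such a \<open>t\<close> is not in \<open>?D\<close>, whereas
      \<open>prescribed\<close> admits into \<open>W'\<close> only sets with indices in
      \<open>?D\<close>.\<close>
    with g obtain t where t: "t \<in> elts (j I)" "t \<notin> range j"
      using j_image_\<kappa>[of g] by (auto simp: bij_betw_def)
    then obtain a where a: "a \<in> M" "vpair t a \<in> elts (j ?AG)" "a \<in> elts W'"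
      using * W' Y by (auto simp: elts_pullback)
    have "t \<in> elts (j ?\<theta>)" using t(1) I(1) j_subset[of I ?\<theta>] by blast
    then have "t \<in> elts ?D" using prescribed[of t a] a by blast
    with t(2) show False by (auto simp: elts_image_set)
  qed
  ultimately show ?thesis
    using complete_ultrafilter_pullback[OF W'] by blast
qed

end

theorem theorem4p1:
  fixes j :: "'v::zfc_universe \<Rightarrow> 'v" and M :: "'v set" and \<kappa> U :: 'v
    and M\<^sub>U :: "'v set" and i\<^sub>U k :: "'v \<Rightarrow> 'v"
  assumes "transitive_class M"
    and "elementary_embedding j UNIV M"
    and "critical_point j \<kappa>"
    and "closed_under_sequences \<kappa> M"
    and "U = derived_ultrafilter j \<kappa>"
    and "M\<^sub>U = ultrapower \<kappa> U"
    and "i\<^sub>U = ult_embedding \<kappa> U"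
    and "k = factor_map j \<kappa>"
    and "image_set j (succ_cardinal \<kappa>) \<in> M"
    and "image_set k (succ_cardinal_in M\<^sub>U (i\<^sub>U \<kappa>)) \<in> M"
  shows "\<exists>W. complete_ultrafilter_over \<kappa> W \<and>
    (\<exists>A. (\<forall>i\<in>elts (succ_cardinal \<kappa>). A i \<in> elts W) \<and>
      (\<forall>I. elts I \<subseteq> elts (succ_cardinal \<kappa>) \<and> elts I \<approx> elts \<kappa> \<longrightarrow>
        vInter \<kappa> I A \<notin> elts W))"
proof -
  interpret embedding j M \<kappa>
    using assms(1-3) by unfold_locales
  show ?thesis
    using assms(9) by (rule ex_non_Galvin)
qed

end
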